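(* Let $G$ be a torsion-free nilpotent group of class $2$, let $<$ be a total order on $G$ making $(G,<)$ an ordered group, and let $S$ be a finite subset of $G$ of size $k\geq 4$ such that $\langle S\rangle$ is non-abelian. Then $|S^2| = 3k-2$ if and only if there exist $a,b,c\in G$ and non-negative integers $i,j$ with $1+i+1+j=k$ such that $$S=\{a, ac, \dots, ac^i, b, bc, \dots, bc^j\},$$ where $c>1$ and either $ab=bac$ or $ba=abc$.
   Context: For a subset $S$ of a group, $S^2=\{s_1s_2 \mid s_1,s_2\in S\}$, and $\langle S\rangle$ is the subgroup generated by $S$. An ordered group $(G,<)$ is a group with a total order such that $x<y$ implies $gxh<gyh$ for all $g,h\in G$. It is known that every torsion-free nilpotent group of class $2$ admits such an order. Here $1$ denotes the identity of $G$. *)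

theory Defs
  imports "HOL-Algebra.Algebra"
begin

definition torsion_free :: "('a, 'b) monoid_scheme \<Rightarrow> bool" where
  "torsion_free G \<longleftrightarrow>
     (\<forall>x\<in>carrier G. \<forall>n::nat. n > 0 \<longrightarrow> x [^]\<^bsub>G\<^esub> n = \<one>\<^bsub>G\<^esub> \<longrightarrow> x = \<one>\<^bsub>G\<^esub>)"

text \<open>The commutator convention is that of \<^const>\<open>derived\<close>; in particular
  \<open>commutator_subgroup G H H = derived G H\<close>.\<close>

definition commutator_subgroup :: "('a, 'b) monoid_scheme \<Rightarrow> 'a set \<Rightarrow> 'a set \<Rightarrow> 'a set" where
  "commutator_subgroup G H K =
     generate G (\<Union>h\<in>H. \<Union>k\<in>K. {h \<otimes>\<^bsub>G\<^esub> k \<otimes>\<^bsub>G\<^esub> inv\<^bsub>G\<^esub> h \<otimes>\<^bsub>G\<^esub> inv\<^bsub>G\<^esub> k})"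

text \<open>Indexed from \<open>0\<close>: \<open>lower_central_series G n\<close> is \<open>\<gamma>\<close> with index \<open>n + 1\<close> in the usual
  notation, so that the nilpotency class is the first \<open>n\<close> at which it is trivial.\<close>

fun lower_central_series :: "('a, 'b) monoid_scheme \<Rightarrow> nat \<Rightarrow> 'a set" where
  "lower_central_series G 0 = carrier G"
| "lower_central_series G (Suc n) = commutator_subgroup G (lower_central_series G n) (carrier G)"

definition nilpotent_of_class :: "('a, 'b) monoid_scheme \<Rightarrow> nat \<Rightarrow> bool" where
  "nilpotent_of_class G n \<longleftrightarrow>
     lower_central_series G n = {\<one>\<^bsub>G\<^esub>} \<and> (\<forall>m<n. lower_central_series G m \<noteq> {\<one>\<^bsub>G\<^esub>})"

text \<open>\<open>(x, y) \<in> R\<close> means \<open>x < y\<close>. Compatibility is two-sided: the group is bi-ordered.\<close>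

locale ordered_group = group G for G (structure) +
  fixes R :: "'a rel"
  assumes order_on_carrier: "R \<subseteq> carrier G \<times> carrier G"
    and strict_linear_order: "strict_linear_order_on (carrier G) R"
    and mult_mono: "\<lbrakk>(x, y) \<in> R; g \<in> carrier G; h \<in> carrier G\<rbrakk>
                      \<Longrightarrow> (g \<otimes> x \<otimes> h, g \<otimes> y \<otimes> h) \<in> R"

end

theory Submission
  imports Defs
begin

text \<open>
  Write \<open>S\<^sup>2\<close> for \<open>S <#> S\<close>. If \<open>S\<close> consists of a progression \<open>a, ac, \<dots>, ac\<^sup>i\<close> and a progression
  \<open>b, bc, \<dots>, bc\<^sup>j\<close> where \<open>c\<close> is the commutator of \<open>a\<close> and \<open>b\<close> up to inversion, then \<open>c\<close> is
  central and \<open>S\<^sup>2\<close> lies in three different cosets of the centre. It has \<open>2i + 1\<close> elements in the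
  coset of \<open>a\<^sup>2\<close> and \<open>2j + 1\<close> in that of \<open>b\<^sup>2\<close>; in the coset of \<open>ab\<close> the two progressions
  starting at \<open>ab\<close> and at \<open>ba\<close> are shifted by one step, so that they cover \<open>i + j + 2\<close>
  elements. The total is \<open>3(i + j + 2) - 2\<close>
  (\<open>card_square_two_progressions\<close>).

  The converse is an induction on \<open>k = card S\<close> in which the greatest element \<open>x\<close> of \<open>S\<close> is
  removed. Let \<open>T = S - {x}\<close>. If \<open>T\<close> does not commute, then \<open>S\<^sup>2\<close> has at least three
  elements outside \<open>T\<^sup>2\<close> (\<open>three_new_products\<close>). If the elements of \<open>S - {y}\<close> commute with
  each other for some \<open>y\<close>, the set \<open>S\<^sup>2\<close> splits into \<open>(S - {y})\<^sup>2\<close>, the products with exactly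
  one factor \<open>y\<close>, and \<open>y\<^sup>2\<close>, which have at least \<open>2k - 3\<close>, \<open>k\<close> and \<open>1\<close> elements. Both cases
  give \<open>card (S\<^sup>2) \<ge> 3k - 2\<close> for non-commuting \<open>S\<close>, and if equality holds for \<open>S\<close>, all the
  estimates are sharp.

  In the second case sharpness forces \<open>S - {y}\<close> to be a progression whose ratio commutes with
  \<open>y\<close> and equals a commutator up to inversion (\<open>two_progressions_if_commuting_part\<close>). In the
  first case equality is inherited by \<open>T\<close>, which is therefore a union of two progressions,
  and \<open>x\<close> contributes only three products. An element outside both cosets of the centre that
  meet \<open>T\<close> contributes at least four (\<open>four_new_products\<close>), and an element of one of these
  cosets has to prolong the progression there (\<open>adjoin_same_coset\<close>).

  The induction starts at \<open>k = 4\<close>. There \<open>T\<close> has three elements, and the argument applies if two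
  of them are congruent modulo the centre; the same holds for \<open>S\<close> without its least element,
  by reversing the order. If in both triples no two elements are congruent, a
  comparison of the few possible coincidences between products excludes equality
  (\<open>four_elements_separated\<close>).
\<close>

section \<open>Order and commutation\<close>

context ordered_group
begin

abbreviation precedes :: "'a \<Rightarrow> 'a \<Rightarrow> bool" (infix "\<lless>" 50)
  where "x \<lless> y \<equiv> (x, y) \<in> R"

lemma less_carrier [dest]: "x \<lless> y \<Longrightarrow> x \<in> carrier G \<and> y \<in> carrier G"
  using order_on_carrier by auto

lemma less_irrefl [simp]: "\<not> x \<lless> x"
  using strict_linear_order unfolding strict_linear_order_on_def irrefl_def by blast

lemma less_trans: "\<lbrakk>x \<lless> y; y \<lless> z\<rbrakk> \<Longrightarrow> x \<lless> z"
  using strict_linear_order unfolding strict_linear_order_on_def trans_def by blast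

lemma less_asym: "\<lbrakk>x \<lless> y; y \<lless> x\<rbrakk> \<Longrightarrow> False"
  using less_trans less_irrefl by blast

lemma less_linear: "\<lbrakk>x \<in> carrier G; y \<in> carrier G; x \<noteq> y\<rbrakk> \<Longrightarrow> x \<lless> y \<or> y \<lless> x"
  using strict_linear_order unfolding strict_linear_order_on_def total_on_def by blast

lemma less_mult_left: "\<lbrakk>x \<lless> y; g \<in> carrier G\<rbrakk> \<Longrightarrow> g \<otimes> x \<lless> g \<otimes> y"
  using mult_mono[of x y g \<one>] less_carrier[of x y] by simp

lemma less_mult_right: "\<lbrakk>x \<lless> y; g \<in> carrier G\<rbrakk> \<Longrightarrow> x \<otimes> g \<lless> y \<otimes> g"
  using mult_mono[of x y \<one> g] less_carrier[of x y] by simp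

lemma less_mult_both: "\<lbrakk>x \<lless> y; u \<lless> v\<rbrakk> \<Longrightarrow> x \<otimes> u \<lless> y \<otimes> v"
  using less_trans[OF less_mult_right[of x y u] less_mult_left[of u v y]] less_carrier by blast

lemma mult_left_cancel_less:
  assumes "g \<in> carrier G" "x \<in> carrier G" "y \<in> carrier G"
  shows "g \<otimes> x \<lless> g \<otimes> y \<longleftrightarrow> x \<lless> y"
  using assms less_asym less_irrefl less_linear less_mult_left by metis

lemma mult_right_cancel_less:
  assumes "g \<in> carrier G" "x \<in> carrier G" "y \<in> carrier G"
  shows "x \<otimes> g \<lless> y \<otimes> g \<longleftrightarrow> x \<lless> y"
  using assms less_asym less_irrefl less_linear less_mult_right by metis

text \<open>The axioms are symmetric under reversing the order, so every statement about greatest elements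
  also holds for least elements.\<close>

lemma ordered_group_converse: "ordered_group G (R\<inverse>)"
proof
  show "R\<inverse> \<subseteq> carrier G \<times> carrier G"
    using order_on_carrier by auto
  show "strict_linear_order_on (carrier G) (R\<inverse>)"
    using strict_linear_order
    by (simp add: strict_linear_order_on_def total_on_def irrefl_def) 
  show "\<And>x y g h. \<lbrakk>(x, y) \<in> R\<inverse>; g \<in> carrier G; h \<in> carrier G\<rbrakk> \<Longrightarrow> (g \<otimes> x \<otimes> h, g \<otimes> y \<otimes> h) \<in> R\<inverse>"
    using mult_mono by simp
qed

lemma finite_has_greatest:
  assumes "finite S" "S \<noteq> {}" "S \<subseteq> carrier G"
  shows "\<exists>x\<in>S. \<forall>y\<in>S. y \<noteq> x \<longrightarrow> y \<lless> x"
  using assms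
proof (induction rule: finite_ne_induct)
  case (insert a F)
  then obtain x where x: "x \<in> F" "\<forall>y\<in>F. y \<noteq> x \<longrightarrow> y \<lless> x" by auto
  have "x \<noteq> a" using x insert by auto
  then have "x \<lless> a \<or> a \<lless> x" using less_linear[of x a] x insert by blast
  then show ?case using x less_trans by (metis insert_iff)
qed simp

lemma obtain_greatest:
  assumes "finite S" "S \<noteq> {}" "S \<subseteq> carrier G"
  obtains x where "x \<in> S" "x \<in> carrier G" "\<And>s. s \<in> S - {x} \<Longrightarrow> s \<lless> x" "\<And>s. s \<in> S \<Longrightarrow> s = x \<or> s \<lless> x"
proof -
  obtain x where "x \<in> S" "\<forall>s\<in>S. s \<noteq> x \<longrightarrow> s \<lless> x" using finite_has_greatest[OF assms] by blast
  then show ?thesis using assms(3) by (intro that[of x]) auto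
qed

lemma pow_strict_mono:
  assumes "x \<lless> y" "0 < n" shows "x [^] (n::nat) \<lless> y [^] n"
  using assms(2)
proof (induction n)
  case (Suc n)
  have xy: "x \<in> carrier G" "y \<in> carrier G" using assms(1) less_carrier by auto
  show ?case
  proof (cases n)
    case 0 then show ?thesis using assms(1) xy by simp
  next
    case (Suc m)
    then have "x [^] n \<lless> y [^] n" using Suc.IH by simp
    then show ?thesis using assms(1) less_mult_both xy by simp
  qed
qed simp

lemma pow_inject:
  assumes "x \<in> carrier G" "y \<in> carrier G" "0 < n" "x [^] (n::nat) = y [^] n"
  shows "x = y"
  using assms less_linear[of x y] pow_strict_mono by (metis less_irrefl)

lemma one_less_pow: "\<lbrakk>\<one> \<lless> c; 0 < n\<rbrakk> \<Longrightarrow> \<one> \<lless> c [^] (n::nat)"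
  using pow_strict_mono[of \<one> c n] by simp

lemma pow_less_pow_iff:
  assumes c: "\<one> \<lless> c" shows "c [^] (m::nat) \<lless> c [^] n \<longleftrightarrow> m < n"
proof -
  have cc: "c \<in> carrier G" using c by auto
  have *: "c [^] m \<lless> c [^] n" if "m < n" for m n :: nat
  proof -
    have "c [^] n = c [^] m \<otimes> c [^] (n - m)" using that cc by (simp add: nat_pow_mult)
    then show ?thesis
      using less_mult_left[OF one_less_pow[OF c, of "n - m"], of "c [^] m"] that cc by simp
  qed
  then show ?thesis by (metis less_asym less_irrefl linorder_neqE_nat)
qed

lemma pow_eq_pow_iff:
  assumes "c \<in> carrier G" "c \<noteq> \<one>" shows "c [^] (m::nat) = c [^] n \<longleftrightarrow> m = n"
proof -
  have *: "m = n" if e: "c [^] m = c [^] n" and mn: "m \<le> n" for m n :: nat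
  proof (rule ccontr)
    assume "m \<noteq> n"
    then have "0 < n - m" using mn by simp
    moreover have "c [^] n = c [^] m \<otimes> c [^] (n - m)" using mn assms by (simp add: nat_pow_mult)
    then have "c [^] (n - m) = \<one> [^] (n - m)" using e assms by simp
    ultimately show False using pow_inject[of c \<one> "n - m"] assms by simp
  qed
  show ?thesis using *[of m n] *[of n m] by (metis nle_le)
qed

lemma commutes_mult:
  assumes "w \<in> carrier G" "p \<in> carrier G" "q \<in> carrier G"
    "w \<otimes> p = p \<otimes> w" "w \<otimes> q = q \<otimes> w"
  shows "w \<otimes> (p \<otimes> q) = p \<otimes> q \<otimes> w"
  using assms by (metis m_assoc)

lemma commutes_mult_left_cancel:
  assumes "w \<in> carrier G" "p \<in> carrier G" "q \<in> carrier G"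
    "w \<otimes> (p \<otimes> q) = p \<otimes> q \<otimes> w" "w \<otimes> p = p \<otimes> w"
  shows "w \<otimes> q = q \<otimes> w"
proof -
  have "p \<otimes> (w \<otimes> q) = p \<otimes> (q \<otimes> w)" using assms by (metis m_assoc)
  then show ?thesis using assms by simp
qed

lemma commutes_mult_right_cancel:
  assumes "w \<in> carrier G" "p \<in> carrier G" "q \<in> carrier G"
    "w \<otimes> (p \<otimes> q) = p \<otimes> q \<otimes> w" "w \<otimes> q = q \<otimes> w"
  shows "w \<otimes> p = p \<otimes> w"
proof -
  have "(w \<otimes> p) \<otimes> q = (p \<otimes> w) \<otimes> q" using assms by (metis m_assoc)
  then show ?thesis using assms by simp
qed

lemma commutes_pow:
  assumes "w \<in> carrier G" "x \<in> carrier G" "w \<otimes> x = x \<otimes> w"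
  shows "w \<otimes> x [^] (n::nat) = x [^] n \<otimes> w"
  using assms by (induction n) (simp_all add: commutes_mult)

lemma mult_inv_cancel_left: "\<lbrakk>w \<in> carrier G; x \<in> carrier G\<rbrakk> \<Longrightarrow> w \<otimes> (inv w \<otimes> x) = x"
  by (simp add: m_assoc[symmetric])

lemma conj_pow:
  assumes "w \<in> carrier G" "x \<in> carrier G"
  shows "(inv w \<otimes> x \<otimes> w) [^] (n::nat) = inv w \<otimes> x [^] n \<otimes> w"
proof (induction n)
  case (Suc n)
  then show ?case using assms by (simp add: m_assoc mult_inv_cancel_left)
qed (use assms in simp)

lemma conj_eq_iff:
  assumes "w \<in> carrier G" "x \<in> carrier G" "y \<in> carrier G"
  shows "inv w \<otimes> x \<otimes> w = y \<longleftrightarrow> x \<otimes> w = w \<otimes> y"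
  using assms by (metis inv_closed inv_solve_left m_assoc m_closed)

text \<open>Roots of an element are unique in an ordered group, and conjugation by \<open>w\<close> maps an
  \<open>n\<close>-th root of \<open>x [^] n\<close> to an \<open>n\<close>-th root of its conjugate. Hence an
  element that commutes with a proper power of \<open>x\<close> commutes with \<open>x\<close>.\<close>

lemma commutes_pow_cancel:
  assumes "w \<in> carrier G" "x \<in> carrier G" "0 < n" "w \<otimes> x [^] (n::nat) = x [^] n \<otimes> w"
  shows "w \<otimes> x = x \<otimes> w"
proof -
  have "(inv w \<otimes> x \<otimes> w) [^] n = x [^] n" using assms conj_pow conj_eq_iff by simp
  then have "inv w \<otimes> x \<otimes> w = x" using assms pow_inject by (metis inv_closed m_closed)
  then show ?thesis using assms conj_eq_iff by metis
qed

lemma commutes_square_cancel: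
  assumes "w \<in> carrier G" "x \<in> carrier G" "w \<otimes> (x \<otimes> x) = x \<otimes> x \<otimes> w"
  shows "w \<otimes> x = x \<otimes> w"
  using commutes_pow_cancel[of w x 2] assms by (simp add: numeral_2_eq_2)

definition progression :: "'a \<Rightarrow> 'a \<Rightarrow> nat \<Rightarrow> 'a set"
  where "progression a c i = {a \<otimes> c [^] n | n :: nat. n \<le> i}"

lemma progression_image: "progression a c i = (\<lambda>n. a \<otimes> c [^] n) ` {..i}"
  unfolding progression_def by auto

lemma finite_progression [simp]: "finite (progression a c i)"
  by (simp add: progression_image)

lemma progressionI: "n \<le> i \<Longrightarrow> a \<otimes> c [^] n \<in> progression a c i"
  unfolding progression_def by blast

lemma progression_closed: "\<lbrakk>a \<in> carrier G; c \<in> carrier G\<rbrakk> \<Longrightarrow> progression a c i \<subseteq> carrier G"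
  unfolding progression_def by auto

lemma card_progression:
  assumes "a \<in> carrier G" "c \<in> carrier G" "c \<noteq> \<one>" shows "card (progression a c i) = Suc i"
proof -
  have "inj_on (\<lambda>n::nat. a \<otimes> c [^] n) {..i}"
    using assms pow_eq_pow_iff by (simp add: inj_on_def)
  then show ?thesis by (simp add: progression_image card_image)
qed

section \<open>Products of a set with its greatest element\<close>

lemma set_multI: "\<lbrakk>x \<in> A; y \<in> B\<rbrakk> \<Longrightarrow> x \<otimes> y \<in> A <#> B"
  unfolding set_mult_def by blast

lemma set_multE:
  assumes "z \<in> A <#> B" obtains x y where "x \<in> A" "y \<in> B" "z = x \<otimes> y"
  using assms unfolding set_mult_def by blast

lemma finite_set_mult: "\<lbrakk>finite A; finite B\<rbrakk> \<Longrightarrow> finite (A <#> B)"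
  unfolding set_mult_def by auto

lemma eq_or_less_if_not_less: "\<lbrakk>x \<in> carrier G; y \<in> carrier G; \<not> x \<lless> y\<rbrakk> \<Longrightarrow> y = x \<or> y \<lless> x"
  using less_linear by blast

lemma mult_less_le_mono: "\<lbrakk>p \<lless> x; q = y \<or> q \<lless> y; y \<in> carrier G\<rbrakk> \<Longrightarrow> p \<otimes> q \<lless> x \<otimes> y"
  using less_mult_both less_mult_right by blast

lemma mult_le_less_mono: "\<lbrakk>p = x \<or> p \<lless> x; q \<lless> y; x \<in> carrier G\<rbrakk> \<Longrightarrow> p \<otimes> q \<lless> x \<otimes> y"
  using less_mult_both less_mult_left by blast

lemma greatest_products_new:
  assumes "x \<in> carrier G" "x' \<in> carrier G"
    and "\<And>t. t \<in> T \<Longrightarrow> t \<lless> x" "\<And>t. t \<in> T \<Longrightarrow> t = x' \<or> t \<lless> x'"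
  shows "x \<otimes> x \<notin> T <#> T" "x \<otimes> x' \<notin> T <#> T" "x' \<otimes> x \<notin> T <#> T"
proof -
  show "x \<otimes> x \<notin> T <#> T"
    using assms less_mult_both less_irrefl by (metis set_multE)
  show "x \<otimes> x' \<notin> T <#> T"
    using assms mult_less_le_mono less_irrefl by (metis set_multE)
  show "x' \<otimes> x \<notin> T <#> T"
    using assms mult_le_less_mono less_irrefl by (metis set_multE)
qed

text \<open>Among the elements of \<open>T\<close> that do not commute with \<open>x\<close>, let \<open>t\<close> be the greatest. If the larger
  of \<open>tx\<close> and \<open>xt\<close> were a product \<open>pq\<close> in \<open>T\<close>, one factor would have to exceed \<open>t\<close>, since both are
  below \<open>x\<close>, and so would commute with \<open>x\<close>. If the other factor exceeds \<open>t\<close> as well, then \<open>x\<close>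
  commutes with \<open>pq\<close> and hence with \<open>t\<close>; otherwise \<open>pq\<close> is below the smaller of the two
  products.\<close>

lemma larger_noncommuting_product_new:
  assumes T: "T \<subseteq> carrier G" and x: "x \<in> carrier G" "\<And>s. s \<in> T \<Longrightarrow> s \<lless> x"
    and t: "t \<in> T" and comm: "\<And>s. \<lbrakk>s \<in> T; t \<lless> s\<rbrakk> \<Longrightarrow> x \<otimes> s = s \<otimes> x"
  shows "x \<otimes> t \<lless> t \<otimes> x \<Longrightarrow> t \<otimes> x \<notin> T <#> T"
    and "t \<otimes> x \<lless> x \<otimes> t \<Longrightarrow> x \<otimes> t \<notin> T <#> T"
proof -
  have tc: "t \<in> carrier G" using t T by auto
  show "t \<otimes> x \<notin> T <#> T" if l: "x \<otimes> t \<lless> t \<otimes> x"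
  proof
    assume "t \<otimes> x \<in> T <#> T"
    then obtain p q where pq: "p \<in> T" "q \<in> T" "t \<otimes> x = p \<otimes> q" by (rule set_multE)
    have c: "p \<in> carrier G" "q \<in> carrier G" using pq T by auto
    have "t \<lless> p"
    proof (rule ccontr)
      assume "\<not> t \<lless> p"
      then have "p \<otimes> q \<lless> t \<otimes> x" using mult_le_less_mono eq_or_less_if_not_less c tc pq x by metis
      then show False using pq by simp
    qed
    then have xp: "x \<otimes> p = p \<otimes> x" using comm pq by blast
    show False
    proof (cases "t \<lless> q")
      case True
      then have "x \<otimes> (t \<otimes> x) = t \<otimes> x \<otimes> x" using comm pq xp commutes_mult c x by metis
      then have "x \<otimes> t = t \<otimes> x" using commutes_mult_right_cancel[of x t x] x tc by simp
      then show False using l by simp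
    next
      case False
      then have "p \<otimes> q \<lless> x \<otimes> t" using mult_less_le_mono eq_or_less_if_not_less c tc pq x by metis
      then show False using pq l less_asym by metis
    qed
  qed
  show "x \<otimes> t \<notin> T <#> T" if l: "t \<otimes> x \<lless> x \<otimes> t"
  proof
    assume "x \<otimes> t \<in> T <#> T"
    then obtain p q where pq: "p \<in> T" "q \<in> T" "x \<otimes> t = p \<otimes> q" by (rule set_multE)
    have c: "p \<in> carrier G" "q \<in> carrier G" using pq T by auto
    have "t \<lless> q"
    proof (rule ccontr)
      assume "\<not> t \<lless> q"
      then have "p \<otimes> q \<lless> x \<otimes> t" using mult_less_le_mono eq_or_less_if_not_less c tc pq x by metis
      then show False using pq by simp
    qed
    then have xq: "x \<otimes> q = q \<otimes> x" using comm pq by blast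
    show False
    proof (cases "t \<lless> p")
      case True
      then have "x \<otimes> (x \<otimes> t) = x \<otimes> t \<otimes> x" using comm pq xq commutes_mult c x by metis
      then have "x \<otimes> t = t \<otimes> x" using commutes_mult_left_cancel[of x x t] x tc by simp
      then show False using l by simp
    next
      case False
      then have "p \<otimes> q \<lless> t \<otimes> x" using mult_le_less_mono eq_or_less_if_not_less c tc pq x by metis
      then show False using pq l less_asym by metis
    qed
  qed
qed

text \<open>This is used when \<open>x\<close> commutes with \<open>T\<close> and yields too few products outside \<open>T <#> T\<close>. An
  equation \<open>xt = pq\<close> with factors below \<open>x\<close> has both factors above \<open>t\<close>, so it expresses
  \<open>t\<close> through \<open>x\<close> and greater elements. Descending from the greatest element \<open>x'\<close>, everything that
  commutes with \<open>x\<close> and \<open>x'\<close> therefore commutes with all of \<open>T\<close>.\<close>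

lemma commutes_all_of_new_products:
  assumes T: "finite T" "T \<subseteq> carrier G" and x: "x \<in> carrier G" "\<And>s. s \<in> T \<Longrightarrow> s \<lless> x"
    and comm: "\<And>s. s \<in> T \<Longrightarrow> x \<otimes> s = s \<otimes> x"
    and old: "\<And>s. \<lbrakk>s \<in> T; s \<noteq> x'\<rbrakk> \<Longrightarrow> x \<otimes> s \<in> T <#> T"
    and s: "s \<in> T" "s \<otimes> x' = x' \<otimes> s" and r: "r \<in> T"
  shows "s \<otimes> r = r \<otimes> s"
proof (rule ccontr)
  assume nc: "s \<otimes> r \<noteq> r \<otimes> s"
  let ?N = "{t \<in> T. s \<otimes> t \<noteq> t \<otimes> s}"
  have "\<exists>t\<in>?N. \<forall>y\<in>?N. y \<noteq> t \<longrightarrow> y \<lless> t"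
    by (rule finite_has_greatest) (use T r nc in auto)
  then obtain t where t: "t \<in> T" "s \<otimes> t \<noteq> t \<otimes> s"
    and gr: "\<And>y. \<lbrakk>y \<in> T; t \<lless> y\<rbrakk> \<Longrightarrow> s \<otimes> y = y \<otimes> s"
    using less_asym by (smt (verit, best) less_irrefl mem_Collect_eq)
  have "t \<noteq> x'" using t s by auto
  then obtain p q where pq: "p \<in> T" "q \<in> T" "x \<otimes> t = p \<otimes> q"
    using old t by (meson set_multE)
  have c: "p \<in> carrier G" "q \<in> carrier G" "t \<in> carrier G" "s \<in> carrier G" using pq t s T by auto
  have "t \<lless> q"
  proof (rule ccontr)
    assume "\<not> t \<lless> q"
    then have "p \<otimes> q \<lless> x \<otimes> t" using mult_less_le_mono eq_or_less_if_not_less c pq x by metis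
    then show False using pq by simp
  qed
  moreover have "t \<lless> p"
  proof (rule ccontr)
    assume "\<not> t \<lless> p"
    then have "p \<otimes> q \<lless> t \<otimes> x" using mult_le_less_mono eq_or_less_if_not_less c pq x by metis
    then show False using pq comm t by simp
  qed
  ultimately have "s \<otimes> (x \<otimes> t) = x \<otimes> t \<otimes> s" using gr pq commutes_mult c by simp
  then show False using commutes_mult_left_cancel[of s x t] c x comm s t by metis
qed

lemma card_ge_3I: "\<lbrakk>finite A; {u, v, w} \<subseteq> A; u \<noteq> v; u \<noteq> w; v \<noteq> w\<rbrakk> \<Longrightarrow> 3 \<le> card A"
  using card_mono[of A "{u, v, w}"] by simp

text \<open>Let \<open>y\<close> be the greatest element of \<open>S - {x}\<close>. The products \<open>xx\<close> and \<open>xy\<close> are too large to be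
  old. The third new product comes from \<open>larger_noncommuting_product_new\<close> if \<open>x\<close> fails to
  commute with some element, and otherwise from \<open>commutes_all_of_new_products\<close>: two new
  products alone would force \<open>S - {x}\<close> to commute.\<close>

lemma three_new_products:
  assumes S: "finite S" "S \<subseteq> carrier G" and x: "x \<in> S" "\<And>s. s \<in> S - {x} \<Longrightarrow> s \<lless> x"
    and nc: "p \<in> S - {x}" "q \<in> S - {x}" "p \<otimes> q \<noteq> q \<otimes> p"
  shows "3 \<le> card ((S <#> S) - ((S - {x}) <#> (S - {x})))"
proof -
  let ?T = "S - {x}" and ?N = "(S <#> S) - ((S - {x}) <#> (S - {x}))"
  have T: "finite ?T" "?T \<subseteq> carrier G" and xc: "x \<in> carrier G" using S x by auto
  have fin: "finite ?N" using S finite_set_mult by simp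
  have "\<exists>y\<in>?T. \<forall>s\<in>?T. s \<noteq> y \<longrightarrow> s \<lless> y"
    by (rule finite_has_greatest) (use T nc in auto)
  then obtain y where y: "y \<in> ?T" and ygr: "\<And>s. s \<in> ?T \<Longrightarrow> s = y \<or> s \<lless> y" by blast
  have yc: "y \<in> carrier G" using y T by auto
  have new: "x \<otimes> x \<notin> ?T <#> ?T" "x \<otimes> y \<notin> ?T <#> ?T" "y \<otimes> x \<notin> ?T <#> ?T"
    using greatest_products_new[of x y ?T] xc yc x(2) ygr by blast+
  have in2: "u \<otimes> v \<in> S <#> S" if "u \<in> S" "v \<in> S" for u v using that set_multI by simp
  have yS: "y \<in> S" using y by simp
  have xx: "x \<otimes> x \<in> ?N" using new(1) in2[OF x(1) x(1)] by simp
  have xy: "x \<otimes> y \<in> ?N" using new(2) in2[OF x(1) yS] by simp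
  have yx: "y \<otimes> x \<in> ?N" using new(3) in2[OF yS x(1)] by simp
  have xxy: "x \<otimes> x \<noteq> x \<otimes> y" "x \<otimes> x \<noteq> y \<otimes> x" using xc yc y by auto
  show ?thesis
  proof (cases "\<exists>t\<in>?T. x \<otimes> t \<noteq> t \<otimes> x")
    case True
    let ?M = "{t \<in> ?T. x \<otimes> t \<noteq> t \<otimes> x}"
    have "\<exists>t\<in>?M. \<forall>s\<in>?M. s \<noteq> t \<longrightarrow> s \<lless> t"
      by (rule finite_has_greatest) (use T True in auto)
    then obtain t where t: "t \<in> ?T" "x \<otimes> t \<noteq> t \<otimes> x"
      and gr: "\<And>s. \<lbrakk>s \<in> ?T; t \<lless> s\<rbrakk> \<Longrightarrow> x \<otimes> s = s \<otimes> x"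
      using less_asym by (smt (verit, best) less_irrefl mem_Collect_eq)
    have tc: "t \<in> carrier G" using t T by auto
    show ?thesis
    proof (cases "t = y")
      case True
      then show ?thesis using card_ge_3I[OF fin, of "x \<otimes> x" "x \<otimes> y" "y \<otimes> x"] xx xy yx xxy t by auto
    next
      case False
      then have ty: "x \<otimes> y = y \<otimes> x" using gr ygr t y by metis
      define w where "w = (if x \<otimes> t \<lless> t \<otimes> x then t \<otimes> x else x \<otimes> t)"
      have "w \<notin> ?T <#> ?T"
        using larger_noncommuting_product_new[OF T(2) xc x(2) t(1) gr] less_linear[of "x \<otimes> t" "t \<otimes> x"]
          t(2) tc xc unfolding w_def by auto
      then have w: "w \<in> ?N" using in2 t x unfolding w_def by auto
      have "x \<otimes> t \<noteq> x \<otimes> x" "t \<otimes> x \<noteq> x \<otimes> x" "x \<otimes> t \<noteq> x \<otimes> y"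
        using False t tc yc xc by auto
      moreover have "t \<otimes> x \<noteq> x \<otimes> y"
        unfolding ty using False tc yc xc by simp
      ultimately have "w \<noteq> x \<otimes> x" "w \<noteq> x \<otimes> y"
        unfolding w_def by simp_all
      then show ?thesis using card_ge_3I[OF fin, of "x \<otimes> x" "x \<otimes> y" w] xx xy w xxy by auto
    qed
  next
    case False
    then have comm: "\<And>s. s \<in> ?T \<Longrightarrow> x \<otimes> s = s \<otimes> x" by blast
    have "\<exists>t\<in>?T. t \<noteq> y \<and> x \<otimes> t \<notin> ?T <#> ?T"
    proof (rule ccontr)
      assume "\<not> ?thesis"
      then have old: "\<And>s. \<lbrakk>s \<in> ?T; s \<noteq> y\<rbrakk> \<Longrightarrow> x \<otimes> s \<in> ?T <#> ?T" by blast
      have "y \<otimes> s = s \<otimes> y" if "s \<in> ?T" for s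
        using commutes_all_of_new_products[OF T xc x(2) comm old y _ that] by simp
      then show False
        using commutes_all_of_new_products[OF T xc x(2) comm old nc(1) _ nc(2)] nc by metis
    qed
    then obtain t where t: "t \<in> ?T" "t \<noteq> y" "x \<otimes> t \<notin> ?T <#> ?T" by blast
    have "x \<otimes> t \<noteq> x \<otimes> x" "x \<otimes> t \<noteq> x \<otimes> y" "x \<otimes> t \<in> ?N" using t xc yc T(2) in2 x by auto
    then show ?thesis using card_ge_3I[OF fin, of "x \<otimes> x" "x \<otimes> y" "x \<otimes> t"] xx xy xxy by auto
  qed
qed

section \<open>Lower bounds for the number of products\<close>

lemma card_square_ge:
  assumes "finite S" "S \<noteq> {}" "S \<subseteq> carrier G"
  shows "2 * card S \<le> card (S <#> S) + 1"
  using assms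
proof (induction "card S" arbitrary: S)
  case (Suc n)
  obtain x where x: "x \<in> S" "x \<in> carrier G" "\<And>s. s \<in> S - {x} \<Longrightarrow> s \<lless> x"
    using obtain_greatest[OF Suc.prems] by metis
  let ?T = "S - {x}"
  have xc: "x \<in> carrier G" using x Suc by auto
  have cT: "card ?T = n" using Suc x by simp
  have xx: "x \<otimes> x \<in> S <#> S" using x set_multI by blast
  have fS: "finite (S <#> S)" using Suc finite_set_mult by blast
  show ?case
  proof (cases "?T = {}")
    case True
    then have "S = {x}" using x(1) by blast
    then show ?thesis by (simp add: set_mult_def)
  next
    case False
    have T: "finite ?T" "?T \<subseteq> carrier G" using Suc.prems by auto
    obtain y where y: "y \<in> ?T" "\<And>s. s \<in> ?T \<Longrightarrow> s = y \<or> s \<lless> y"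
      using obtain_greatest[OF T(1) False T(2)] by metis
    have yc: "y \<in> carrier G" using y T by auto
    have new: "x \<otimes> x \<notin> ?T <#> ?T" "x \<otimes> y \<notin> ?T <#> ?T"
      using greatest_products_new[of x y ?T] xc yc x(3) y(2) by blast+
    have IH: "2 * card ?T \<le> card (?T <#> ?T) + 1" using Suc.hyps(1)[of ?T] cT T False by simp
    have "insert (x \<otimes> x) (insert (x \<otimes> y) (?T <#> ?T)) \<subseteq> S <#> S"
      using x(1) y(1) unfolding set_mult_def by blast
    then have "card (insert (x \<otimes> x) (insert (x \<otimes> y) (?T <#> ?T))) \<le> card (S <#> S)"
      using fS card_mono by blast
    moreover have "card (insert (x \<otimes> x) (insert (x \<otimes> y) (?T <#> ?T))) = card (?T <#> ?T) + 2"
    proof -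
      have "x \<otimes> x \<noteq> x \<otimes> y" using xc yc y(1) by auto
      then show ?thesis using new finite_set_mult[OF T(1) T(1)] by simp
    qed
    ultimately show ?thesis using IH cT Suc.hyps(2) by linarith
  qed
qed simp

text \<open>Both translates of \<open>T\<close> have \<open>card T\<close> elements, and they differ: if \<open>s\<close> is the greatest element
  that does not commute with \<open>y\<close>, the larger of \<open>ys\<close> and \<open>sy\<close> could lie in the other
  translate only through an element above \<open>s\<close>, which commutes with \<open>y\<close>.\<close>

lemma card_two_sided_ge:
  assumes "finite T" "T \<subseteq> carrier G" "y \<in> carrier G" "t \<in> T" "y \<otimes> t \<noteq> t \<otimes> y"
  shows "card T + 1 \<le> card ((\<lambda>t. y \<otimes> t) ` T \<union> (\<lambda>t. t \<otimes> y) ` T)"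
proof -
  let ?L = "(\<lambda>t. y \<otimes> t) ` T" and ?Q = "(\<lambda>t. t \<otimes> y) ` T"
  have cL: "card ?L = card T" "card ?Q = card T"
    by (rule card_image, rule inj_onI, use assms in \<open>auto simp: subset_iff\<close>)+
  have "?L \<noteq> ?Q"
  proof
    assume eq: "?L = ?Q"
    let ?N = "{t \<in> T. y \<otimes> t \<noteq> t \<otimes> y}"
    have "\<exists>t\<in>?N. \<forall>s\<in>?N. s \<noteq> t \<longrightarrow> s \<lless> t"
      by (rule finite_has_greatest) (use assms in auto)
    then obtain s where s: "s \<in> T" "y \<otimes> s \<noteq> s \<otimes> y"
      and gr: "\<And>u. \<lbrakk>u \<in> T; s \<lless> u\<rbrakk> \<Longrightarrow> y \<otimes> u = u \<otimes> y"
      using less_asym by (smt (verit, best) less_irrefl mem_Collect_eq)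
    have sc: "s \<in> carrier G" using s assms by auto
    consider "y \<otimes> s \<lless> s \<otimes> y" | "s \<otimes> y \<lless> y \<otimes> s"
      using less_linear s sc assms by (metis m_closed)
    then show False
    proof cases
      case 1
      have "s \<otimes> y \<in> ?L" using eq s by blast
      then obtain u where u: "u \<in> T" "s \<otimes> y = y \<otimes> u" by blast
      have uc: "u \<in> carrier G" using u assms by auto
      then have "s \<lless> u" using 1 u mult_left_cancel_less sc assms by metis
      then have "s \<otimes> y = u \<otimes> y" using gr u by simp
      then have "s = u" using sc uc assms by simp
      then show False using \<open>s \<lless> u\<close> by simp
    next
      case 2
      have "y \<otimes> s \<in> ?Q" using eq s by blast
      then obtain u where u: "u \<in> T" "y \<otimes> s = u \<otimes> y" by blast
      have uc: "u \<in> carrier G" using u assms by auto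
      then have "s \<lless> u" using 2 u mult_right_cancel_less sc assms by metis
      then have "y \<otimes> s = y \<otimes> u" using gr u by simp
      then have "s = u" using sc uc assms by simp
      then show False using \<open>s \<lless> u\<close> by simp
    qed
  qed
  then have "?L \<subset> ?L \<union> ?Q"
    using card_subset_eq[of ?L ?Q] cL assms(1) by (metis Un_upper1 card_subset_eq finite_imageI psubsetI subset_Un_eq sup_commute)
  then show ?thesis using psubset_card_mono[of "?L \<union> ?Q" ?L] cL assms(1) by simp
qed

text \<open>The three parts of the square are disjoint because \<open>T <#> T\<close> commutes with \<open>t\<close>, whereas \<open>y\<close>
  does not: a product \<open>ys\<close> commutes with \<open>t\<close> only if \<open>y\<close> does, and the same holds for \<open>yy\<close>.\<close>

lemma card_square_insert_commuting:
  assumes T: "finite T" "T \<subseteq> carrier G" and y: "y \<in> carrier G"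
    and comm: "\<And>s t. \<lbrakk>s \<in> T; t \<in> T\<rbrakk> \<Longrightarrow> s \<otimes> t = t \<otimes> s"
    and t: "t \<in> T" "y \<otimes> t \<noteq> t \<otimes> y"
  shows "card (insert y T <#> insert y T)
    = card (T <#> T) + card ((\<lambda>t. y \<otimes> t) ` T \<union> (\<lambda>t. t \<otimes> y) ` T) + 1"
proof -
  let ?U = "(\<lambda>t. y \<otimes> t) ` T \<union> (\<lambda>t. t \<otimes> y) ` T"
  have eq: "insert y T <#> insert y T = insert (y \<otimes> y) ((T <#> T) \<union> ?U)"
    unfolding set_mult_def by blast
  have tc: "t \<in> carrier G" using t T by auto
  have yT: "y \<notin> T" using t comm by blast
  have c2: "t \<otimes> u = u \<otimes> t" if "u \<in> T <#> T" for u
    using that by (rule set_multE) (use comm commutes_mult tc T t in \<open>metis subset_iff\<close>)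
  have "(T <#> T) \<inter> ?U = {}"
  proof -
    have "y \<otimes> s \<notin> T <#> T" if "s \<in> T" for s
      using c2 commutes_mult_right_cancel[of t y s] comm that t tc y T by (metis subsetD)
    moreover have "s \<otimes> y \<notin> T <#> T" if "s \<in> T" for s
      using c2 commutes_mult_left_cancel[of t s y] comm that t tc y T by (metis subsetD)
    ultimately show ?thesis by auto
  qed
  moreover have "y \<otimes> y \<notin> T <#> T"
    using c2 commutes_square_cancel[of t y] t tc y by metis
  moreover have "y \<otimes> y \<notin> ?U" using yT y T(2) by auto
  moreover have "finite (T <#> T)" "finite ?U" using T finite_set_mult by auto
  ultimately show ?thesis unfolding eq by (simp add: card_Un_disjoint)
qed

lemma card_square_ge_noncommuting:
  assumes "finite S" "S \<subseteq> carrier G" "p \<in> S" "q \<in> S" "p \<otimes> q \<noteq> q \<otimes> p"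
  shows "3 * card S \<le> card (S <#> S) + 2"
  using assms
proof (induction "card S" arbitrary: S p q)
  case (Suc n)
  have "S \<noteq> {}" using Suc.prems by blast
  then obtain x where x: "x \<in> S" "\<And>s. s \<in> S - {x} \<Longrightarrow> s \<lless> x"
    using obtain_greatest[OF Suc.prems(1) _ Suc.prems(2)] by metis
  let ?T = "S - {x}"
  have xc: "x \<in> carrier G" using x Suc by auto
  have cT: "card ?T = n" using Suc x by simp
  have T: "finite ?T" "?T \<subseteq> carrier G" using Suc.prems by auto
  show ?case
  proof (cases "\<exists>p\<in>?T. \<exists>q\<in>?T. p \<otimes> q \<noteq> q \<otimes> p")
    case True
    then obtain p' q' where pq: "p' \<in> ?T" "q' \<in> ?T" "p' \<otimes> q' \<noteq> q' \<otimes> p'" by blast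
    have "3 * card ?T \<le> card (?T <#> ?T) + 2"
      using Suc.hyps(1)[of ?T p' q'] pq T cT by simp
    moreover have "3 \<le> card ((S <#> S) - (?T <#> ?T))"
      using three_new_products[OF Suc.prems(1,2) x pq] .
    moreover have "?T <#> ?T \<subseteq> S <#> S" using mono_set_mult[of ?T S ?T S] by blast
    ultimately show ?thesis
      using cT Suc.hyps(2) card_Diff_subset[of "?T <#> ?T" "S <#> S"] finite_set_mult T(1)
        card_mono[of "S <#> S" "?T <#> ?T"] Suc.prems(1) by fastforce
  next
    case False
    then obtain t where t: "t \<in> ?T" "x \<otimes> t \<noteq> t \<otimes> x"
      using Suc.prems by (metis Diff_iff singletonD)
    have "card (S <#> S) = card (?T <#> ?T) + card ((\<lambda>t. x \<otimes> t) ` ?T \<union> (\<lambda>t. t \<otimes> x) ` ?T) + 1"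
      using card_square_insert_commuting[OF T xc _ t] False x(1) by (simp add: insert_absorb)
    moreover have "2 * card ?T \<le> card (?T <#> ?T) + 1" using card_square_ge T t by blast
    ultimately show ?thesis using card_two_sided_ge[OF T xc t] cT Suc.hyps(2) by linarith
  qed
qed simp

section \<open>Sets with few products: geometric progressions\<close>

lemma progression_Suc: "progression t d (Suc N) = insert (t \<otimes> d [^] Suc N) (progression t d N)"
  unfolding progression_image atMost_Suc by simp

lemma pow_mult_commute:
  assumes "t \<in> carrier G" "d \<in> carrier G" "t \<otimes> d = d \<otimes> t"
  shows "(t \<otimes> d [^] (m::nat)) \<otimes> (t \<otimes> d [^] (n::nat)) = t \<otimes> (t \<otimes> d [^] (m + n))"
proof -
  have "d [^] m \<otimes> t = t \<otimes> d [^] m" using commutes_pow assms by simp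
  then have "d [^] m \<otimes> (t \<otimes> d [^] n) = t \<otimes> (d [^] m \<otimes> d [^] n)"
    using assms by (metis m_assoc nat_pow_closed)
  then show ?thesis using assms by (simp add: m_assoc nat_pow_mult)
qed

text \<open>Removing the greatest element \<open>x\<close> loses at least two products, so the remaining set is again
  extremal and by induction a progression with last terms \<open>v\<close> and \<open>vd\<close>. A third lost product is
  impossible, hence \<open>xv\<close> is a product of terms of the progression. As \<open>x\<close> exceeds \<open>vd\<close>,
  this product can only be \<open>vd vd\<close>, and \<open>x\<close> is the next term.\<close>

lemma progression_if_small_square:
  assumes "finite T" "T \<subseteq> carrier G" "2 \<le> card T" "card (T <#> T) + 1 \<le> 2 * card T"
    and "\<And>s t. \<lbrakk>s \<in> T; t \<in> T\<rbrakk> \<Longrightarrow> s \<otimes> t = t \<otimes> s"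
  shows "\<exists>t\<in>carrier G. \<exists>d. \<one> \<lless> d \<and> t \<otimes> d = d \<otimes> t \<and> T = progression t d (card T - 1)"
  using assms
proof (induction "card T" arbitrary: T rule: less_induct)
  case less
  note T = less.prems(1,2) and comm = less.prems(5)
  have "T \<noteq> {}" using less.prems(3) by auto
  then obtain x where x: "x \<in> T" "x \<in> carrier G" "\<And>s. s \<in> T - {x} \<Longrightarrow> s \<lless> x"
    using obtain_greatest[OF T(1) _ T(2)] by metis
  let ?U = "T - {x}"
  have U: "finite ?U" "?U \<subseteq> carrier G" and cU: "card ?U = card T - 1" using T x by auto
  have fT: "finite (T <#> T)" "finite (?U <#> ?U)" using T U finite_set_mult by auto
  show ?case
  proof (cases "card T = 2")
    case True
    then have "card ?U = 1" using cU by simp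
    then obtain t where t: "?U = {t}" using card_1_singletonE by blast
    then have tT: "t \<in> T" "t \<lless> x" using x(3)[of t] by auto
    have tc: "t \<in> carrier G" using tT T by auto
    let ?d = "inv t \<otimes> x"
    have td: "t \<otimes> ?d = x" using tc x mult_inv_cancel_left by simp
    have "\<one> \<lless> ?d" using less_mult_left[OF tT(2), of "inv t"] tc by simp
    moreover have "t \<otimes> ?d = ?d \<otimes> t"
      using commutes_mult_left_cancel[of t t ?d] comm[OF tT(1) x(1)] tc x td by simp
    moreover have "T = progression t ?d 1"
      using t td tc x(1,2) unfolding progression_image
      by (simp add: atMost_Suc) blast
    ultimately show ?thesis using tc True by (metis One_nat_def diff_Suc_1 numeral_2_eq_2)
  next
    case False
    obtain y where y: "y \<in> ?U" "y \<in> carrier G" "\<And>s. s \<in> ?U \<Longrightarrow> s = y \<or> s \<lless> y"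
    proof -
      have "card ?U \<noteq> 0" using False less.prems(3) cU by linarith
      then have "?U \<noteq> {}" by (metis card.empty)
      then show ?thesis using obtain_greatest[OF U(1) _ U(2)] that by metis
    qed
    have new: "x \<otimes> x \<notin> ?U <#> ?U" "x \<otimes> y \<notin> ?U <#> ?U"
      using greatest_products_new[of x y ?U] x(2,3) y(2,3) by blast+
    have ne: "x \<otimes> x \<noteq> x \<otimes> y" using x(2) y by auto
    have in2: "insert (x \<otimes> x) (insert (x \<otimes> y) (?U <#> ?U)) \<subseteq> T <#> T"
      using x(1) y(1) unfolding set_mult_def by blast
    have cins: "card (insert (x \<otimes> x) (insert (x \<otimes> y) (?U <#> ?U))) = card (?U <#> ?U) + 2"
      using new ne fT by simp
    then have "card (?U <#> ?U) + 2 \<le> card (T <#> T)"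
      using card_mono[OF fT(1) in2] by simp
    then have sq: "card (?U <#> ?U) + 1 \<le> 2 * card ?U" using cU less.prems(3,4) by linarith
    have U2: "2 \<le> card ?U" using False less.prems(3) cU by linarith
    obtain t d where td: "t \<in> carrier G" "\<one> \<lless> d" "t \<otimes> d = d \<otimes> t"
      and Up: "?U = progression t d (card ?U - 1)"
    proof -
      have "card ?U < card T" using cU less.prems(3) by linarith
      moreover have "\<And>s t. \<lbrakk>s \<in> ?U; t \<in> ?U\<rbrakk> \<Longrightarrow> s \<otimes> t = t \<otimes> s" using comm by blast
      ultimately show ?thesis
        using less.hyps[of ?U] U U2 sq that by blast
    qed
    have dc: "d \<in> carrier G" using td by auto
    define N where "N = card ?U - 2"
    have N: "card ?U - 1 = Suc N" using U2 unfolding N_def by linarith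
    have Up: "?U = progression t d (Suc N)" using Up N by simp
    let ?v = "t \<otimes> d [^] N"
    have vU: "?v \<in> ?U" unfolding Up by (rule progressionI) simp
    have tU: "t \<otimes> d [^] Suc N \<in> ?U" unfolding Up by (rule progressionI) simp
    have vy: "?v \<noteq> y"
    proof
      assume "?v = y"
      then have "t \<otimes> d [^] Suc N = ?v \<or> t \<otimes> d [^] Suc N \<lless> ?v" using y(3) tU by simp
      moreover have "?v \<lless> t \<otimes> d [^] Suc N"
        using less_mult_left[OF _ td(1)] pow_less_pow_iff[OF td(2), of N "Suc N"] lessI by blast
      ultimately show False using less_asym less_irrefl by metis
    qed
    \<comment> \<open>Otherwise \<open>xx\<close>, \<open>xy\<close> and \<open>x ?v\<close> would be three new products.\<close>
    have "x \<otimes> ?v \<in> ?U <#> ?U"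
    proof (rule ccontr)
      assume n: "x \<otimes> ?v \<notin> ?U <#> ?U"
      have ne': "x \<otimes> ?v \<noteq> x \<otimes> x" "x \<otimes> ?v \<noteq> x \<otimes> y"
        using vU vy x(2) y(2) U(2) by auto
      have "insert (x \<otimes> ?v) (insert (x \<otimes> x) (insert (x \<otimes> y) (?U <#> ?U))) \<subseteq> T <#> T"
        using in2 x(1) vU unfolding set_mult_def by blast
      from card_mono[OF fT(1) this]
      have "card (?U <#> ?U) + 3 \<le> card (T <#> T)" using cins n ne' fT by simp
      moreover have "2 * card ?U \<le> card (?U <#> ?U) + 1" using card_square_ge[OF U(1) _ U(2)] y(1) by blast
      ultimately show False using cU less.prems(3,4) by linarith
    qed
    then obtain m n where mn: "m \<le> Suc N" "n \<le> Suc N"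
      "x \<otimes> ?v = (t \<otimes> d [^] m) \<otimes> (t \<otimes> d [^] n)"
      unfolding Up progression_def set_mult_def by blast
    have tT: "t \<in> T"
      using progressionI[of 0 "Suc N" t d] td Up by auto
    have "t \<otimes> (x \<otimes> d [^] N) = t \<otimes> (t \<otimes> d [^] (m + n))"
      using mn pow_mult_commute[OF td(1) dc td(3)] comm[OF tT x(1)] td(1) dc x(2)
      by (metis m_assoc nat_pow_closed)
    then have eq: "x \<otimes> d [^] N = t \<otimes> d [^] (m + n)"
      using td dc x(2) by simp
    have "t \<otimes> d [^] Suc N \<otimes> d [^] N \<lless> x \<otimes> d [^] N"
      using less_mult_right[OF x(3)[OF tU]] dc by blast
    then have "t \<otimes> d [^] (Suc N + N) \<lless> t \<otimes> d [^] (m + n)"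
      using eq td dc by (simp only: m_assoc nat_pow_mult nat_pow_closed)
    then have "Suc N + N < m + n"
      using mult_left_cancel_less pow_less_pow_iff[OF td(2)] td(1) dc by (metis nat_pow_closed)
    then have "m + n = Suc (Suc N) + N" using mn by linarith
    then have "x \<otimes> d [^] N = t \<otimes> d [^] Suc (Suc N) \<otimes> d [^] N"
      using eq td dc by (simp only: m_assoc nat_pow_mult nat_pow_closed)
    then have "x = t \<otimes> d [^] Suc (Suc N)" using td dc x(2) by (metis m_closed nat_pow_closed r_cancel)
    then have "T = progression t d (Suc (Suc N))"
      using Up x(1) progression_Suc[of t d "Suc N"] by (metis insert_Diff)
    moreover have "card T - 1 = Suc (Suc N)" using N cU by simp
    ultimately show ?thesis using td by auto
  qed
qed

text \<open>The two progressions must overlap, so one starting point is the other one times a power of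
  \<open>d\<close>. An exponent of two or more would leave two terms of the shifted progression uncovered.\<close>

lemma translated_progressions_step:
  assumes "u \<in> carrier G" "v \<in> carrier G" "\<one> \<lless> d" "u \<noteq> v" "0 < N"
    and "card (progression u d N \<union> progression v d N) \<le> N + 2"
  shows "u = v \<otimes> d \<or> v = u \<otimes> d"
proof -
  have dc: "d \<in> carrier G" "d \<noteq> \<one>" using assms by auto
  have step: "u = v \<otimes> d"
    if e: "u \<otimes> d [^] n = v \<otimes> d [^] p" and np: "n \<le> p" and c: "u \<in> carrier G" "v \<in> carrier G" "u \<noteq> v"
      and card: "card (progression u d N \<union> progression v d N) \<le> N + 2" for u v and n p :: nat
  proof -
    define r where "r = p - n"
    have "u \<otimes> d [^] n = v \<otimes> d [^] r \<otimes> d [^] n"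
      using e np c dc by (simp add: m_assoc nat_pow_mult r_def)
    then have ur: "u = v \<otimes> d [^] r" using c dc by (metis m_closed nat_pow_closed r_cancel)
    have "r \<noteq> 0" using ur c by (cases r) auto
    moreover have "\<not> 2 \<le> r"
    proof
      assume r: "2 \<le> r"
      let ?a = "u \<otimes> d [^] N" and ?b = "u \<otimes> d [^] (N - 1)"
      have eq: "?a = v \<otimes> d [^] (r + N)" "?b = v \<otimes> d [^] (r + (N - 1))"
        using ur c dc by (simp_all add: m_assoc nat_pow_mult)
      have notin: "v \<otimes> d [^] k \<notin> progression v d N" if "N < k" for k :: nat
        using that c dc pow_eq_pow_iff[of d] unfolding progression_def by auto
      have "?a \<notin> progression v d N" "?b \<notin> progression v d N"
        unfolding eq by (rule notin, use r assms(5) in simp)+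
      moreover have "?a \<noteq> ?b" using c dc assms(5) pow_eq_pow_iff[of d N "N - 1"] by simp
      moreover have "{?a, ?b} \<union> progression v d N \<subseteq> progression u d N \<union> progression v d N"
        using progressionI[of N N u d] progressionI[of "N - 1" N u d] by auto
      then have "card ({?a, ?b} \<union> progression v d N) \<le> N + 2"
        using card card_mono[of "progression u d N \<union> progression v d N"]
        by (meson finite_UnI finite_progression order_trans)
      ultimately show False using card_progression[OF c(2) dc, of N] by simp
    qed
    ultimately have "r = 1" by linarith
    then show ?thesis using ur dc by simp
  qed
  have "progression u d N \<inter> progression v d N \<noteq> {}"
  proof
    assume "progression u d N \<inter> progression v d N = {}"
    then show False
      using assms card_progression dc card_Un_disjoint[of "progression u d N" "progression v d N"] by simp
  qed
  then obtain n p :: nat where "u \<otimes> d [^] n = v \<otimes> d [^] p"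
    unfolding progression_def by auto
  then show ?thesis
    using step[of u n v p] step[of v p u n] assms by (metis Un_commute nle_le)
qed

end

section \<open>Cosets of the centre in class two\<close>

locale ordered_class2_group = ordered_group +
  assumes commutator_central: "\<lbrakk>x \<in> carrier G; y \<in> carrier G; g \<in> carrier G\<rbrakk>
    \<Longrightarrow> (x \<otimes> y \<otimes> inv x \<otimes> inv y) \<otimes> g = g \<otimes> (x \<otimes> y \<otimes> inv x \<otimes> inv y)"
begin

text \<open>Centrality, cosets and progressions depend on the group alone, so results
  obtained for the converse order speak about the same objects.\<close>

lemma ordered_class2_group_converse: "ordered_class2_group G (R\<inverse>)"
  using ordered_group_converse commutator_central
  by (simp add: ordered_class2_group_def ordered_class2_group_axioms_def)

definition central :: "'a \<Rightarrow> bool"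
  where "central z \<longleftrightarrow> z \<in> carrier G \<and> (\<forall>g\<in>carrier G. z \<otimes> g = g \<otimes> z)"

lemma central_carrier [dest]: "central z \<Longrightarrow> z \<in> carrier G"
  by (simp add: central_def)

lemma central_commutes: "\<lbrakk>central z; g \<in> carrier G\<rbrakk> \<Longrightarrow> z \<otimes> g = g \<otimes> z"
  by (simp add: central_def)

lemma central_mult: "\<lbrakk>central y; central z\<rbrakk> \<Longrightarrow> central (y \<otimes> z)"
  unfolding central_def by (metis commutes_mult m_closed)

lemma central_inv: "central z \<Longrightarrow> central (inv z)"
  unfolding central_def by (metis inv_closed inv_solve_left inv_solve_right m_assoc m_closed)

lemma central_pow: "central z \<Longrightarrow> central (z [^] (n::nat))"
  unfolding central_def by (metis commutes_pow nat_pow_closed)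

lemma central_pow_cancel:
  assumes "x \<in> carrier G" "0 < n" "central (x [^] (n::nat))" shows "central x"
  using assms commutes_pow_cancel[of _ x n] unfolding central_def by metis

lemma central_one: "central \<one>"
  by (simp add: central_def)

lemma mult_central_move:
  assumes "central z" "x \<in> carrier G" "y \<in> carrier G"
  shows "x \<otimes> z \<otimes> y = x \<otimes> y \<otimes> z"
  using assms by (metis central_commutes central_carrier m_assoc)

text \<open>Congruence modulo the centre, encoded as equality of sets so that it can be used in rewriting
  and chained like any other equation.\<close>

definition coset :: "'a \<Rightarrow> 'a set"
  where "coset x = {x \<otimes> z | z. central z}"

lemma coset_eq_iff:
  assumes "x \<in> carrier G" "y \<in> carrier G"
  shows "coset x = coset y \<longleftrightarrow> (\<exists>z. central z \<and> y = x \<otimes> z)"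
proof
  assume e: "coset x = coset y"
  have "y \<otimes> \<one> \<in> coset y" using central_one unfolding coset_def by blast
  then have "y \<in> coset x" using e assms by simp
  then show "\<exists>z. central z \<and> y = x \<otimes> z" unfolding coset_def by blast
next
  assume "\<exists>z. central z \<and> y = x \<otimes> z"
  then obtain z where z: "central z" "y = x \<otimes> z" by blast
  have zc: "z \<in> carrier G" using z by auto
  have "x \<otimes> w \<in> coset y" if "central w" for w
  proof -
    have "x \<otimes> w = y \<otimes> (inv z \<otimes> w)"
      using z(2) zc that assms by (simp add: m_assoc mult_inv_cancel_left central_carrier)
    then show ?thesis using central_mult central_inv z(1) that unfolding coset_def by blast
  qed
  moreover have "y \<otimes> w \<in> coset x" if "central w" for w
  proof -
    have "y \<otimes> w = x \<otimes> (z \<otimes> w)" using z(2) zc that assms by (simp add: m_assoc central_carrier)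
    then show ?thesis using central_mult z(1) that unfolding coset_def by blast
  qed
  ultimately show "coset x = coset y" unfolding coset_def[of x] coset_def[of y]
    unfolding coset_def by blast
qed

lemma coset_mult_central: "\<lbrakk>x \<in> carrier G; central z\<rbrakk> \<Longrightarrow> coset (x \<otimes> z) = coset x"
  using coset_eq_iff[of x "x \<otimes> z"] central_carrier by auto

lemma coset_mult_commute:
  assumes "x \<in> carrier G" "y \<in> carrier G" shows "coset (x \<otimes> y) = coset (y \<otimes> x)"
proof -
  let ?z = "inv x \<otimes> inv y \<otimes> x \<otimes> y"
  have "central ?z"
    using commutator_central[of "inv x" "inv y"] assms unfolding central_def by simp
  moreover have "x \<otimes> y = y \<otimes> x \<otimes> ?z"
    using assms by (simp add: m_assoc mult_inv_cancel_left)
  ultimately show ?thesis using coset_mult_central[of "y \<otimes> x" ?z] assms by simp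
qed

lemma coset_mult_cong:
  assumes "x \<in> carrier G" "y \<in> carrier G" "u \<in> carrier G" "v \<in> carrier G"
    and "coset x = coset y" "coset u = coset v"
  shows "coset (x \<otimes> u) = coset (y \<otimes> v)"
proof -
  obtain z w where z: "central z" "y = x \<otimes> z" and w: "central w" "v = u \<otimes> w"
    using assms coset_eq_iff by metis
  have "y \<otimes> v = (x \<otimes> u) \<otimes> (z \<otimes> w)"
    using assms(1,3) z w by (metis central_carrier m_assoc m_closed mult_central_move)
  then show ?thesis using coset_mult_central[of "x \<otimes> u" "z \<otimes> w"] central_mult z w assms by simp
qed

lemma coset_mult_left_cancel:
  assumes "g \<in> carrier G" "x \<in> carrier G" "y \<in> carrier G"
  shows "coset (g \<otimes> x) = coset (g \<otimes> y) \<longleftrightarrow> coset x = coset y"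
proof
  assume "coset (g \<otimes> x) = coset (g \<otimes> y)"
  then obtain z where z: "central z" "g \<otimes> y = g \<otimes> x \<otimes> z" using coset_eq_iff assms by (metis m_closed)
  then have "y = x \<otimes> z" using assms by (simp add: m_assoc central_carrier)
  then show "coset x = coset y" using z coset_eq_iff assms by blast
qed (use assms coset_mult_cong in blast)

lemma coset_mult_right_cancel:
  assumes "g \<in> carrier G" "x \<in> carrier G" "y \<in> carrier G"
  shows "coset (x \<otimes> g) = coset (y \<otimes> g) \<longleftrightarrow> coset x = coset y"
  using coset_mult_left_cancel coset_mult_commute assms by metis

lemma coset_commutes:
  assumes "w \<in> carrier G" "x \<in> carrier G" "y \<in> carrier G" "coset x = coset y" "w \<otimes> x = x \<otimes> w"
  shows "w \<otimes> y = y \<otimes> w"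
proof -
  obtain z where z: "central z" "y = x \<otimes> z" using coset_eq_iff assms by metis
  show ?thesis using commutes_mult[of w x z] central_commutes[of z w] z assms by auto
qed

lemma coset_eq_commutes:
  assumes "x \<in> carrier G" "y \<in> carrier G" "coset x = coset y"
  shows "x \<otimes> y = y \<otimes> x"
  using coset_commutes[of x x y] assms by simp

text \<open>Commuting with \<open>w\<close> is a linear condition modulo the centre: it passes from three of the
  elements in a relation \<open>pq = rs\<close> to the fourth.\<close>

lemma coset_commutes_four:
  assumes "p \<in> carrier G" "q \<in> carrier G" "r \<in> carrier G" "s \<in> carrier G" "w \<in> carrier G"
    and "coset (p \<otimes> q) = coset (r \<otimes> s)"
    and "w \<otimes> p = p \<otimes> w" "w \<otimes> q = q \<otimes> w" "w \<otimes> r = r \<otimes> w"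
  shows "w \<otimes> s = s \<otimes> w"
  using assms coset_commutes[of w "p \<otimes> q" "r \<otimes> s"] commutes_mult[of w p q]
    commutes_mult_left_cancel[of w r s] by simp

text \<open>The quotient by the centre is torsion-free, because an element with a central proper power is
  itself central.\<close>

lemma coset_square_cancel:
  assumes "x \<in> carrier G" "y \<in> carrier G" "coset (x \<otimes> x) = coset (y \<otimes> y)"
  shows "coset x = coset y"
proof -
  let ?w = "inv x \<otimes> y"
  have w: "?w \<in> carrier G" "y = x \<otimes> ?w" using assms by (simp_all add: mult_inv_cancel_left)
  have "coset (x \<otimes> (x \<otimes> \<one>)) = coset (x \<otimes> (?w \<otimes> (x \<otimes> ?w)))"
    using assms w by (metis m_assoc r_one)
  then have "coset (x \<otimes> \<one>) = coset (?w \<otimes> (x \<otimes> ?w))"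
    using coset_mult_left_cancel assms w by (metis m_closed one_closed)
  also have "\<dots> = coset (x \<otimes> (?w \<otimes> ?w))"
    using coset_mult_commute[of ?w "x \<otimes> ?w"] assms w by (metis m_assoc m_closed)
  finally have "coset \<one> = coset (?w \<otimes> ?w)"
    using coset_mult_left_cancel[of x \<one> "?w \<otimes> ?w"] assms w(1) by simp
  then have "central (?w \<otimes> ?w)" using coset_eq_iff w(1) by (metis l_one m_closed one_closed central_carrier)
  then have "central ?w" using central_pow_cancel[of ?w 2] w(1) by (simp add: numeral_2_eq_2)
  then show ?thesis using coset_mult_central[of x ?w] w(1) w(2)[symmetric] assms by simp
qed

text \<open>In additive notation modulo the centre, \<open>x + b = 2a\<close> and \<open>2x = a + b\<close> give \<open>3a = 3b\<close>. Then \<open>b\<close>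
  commutes with the cube of \<open>a\<close>, hence with \<open>a\<close>.\<close>

lemma coset_no_cubic_relation:
  assumes "a \<in> carrier G" "b \<in> carrier G" "x \<in> carrier G"
    and xb: "coset (x \<otimes> b) = coset (a \<otimes> a)" and xx: "coset (x \<otimes> x) = coset (a \<otimes> b)"
  shows "a \<otimes> b = b \<otimes> a"
proof -
  note [simp] = assms(1-3)
  have "coset (b \<otimes> (x \<otimes> b)) = coset (x \<otimes> (b \<otimes> b))"
    using coset_mult_commute[of b "x \<otimes> b"] by (simp add: m_assoc)
  then have "coset (x \<otimes> (b \<otimes> (x \<otimes> b))) = coset (x \<otimes> (x \<otimes> (b \<otimes> b)))"
    by (simp add: coset_mult_left_cancel)
  moreover have "coset (x \<otimes> b \<otimes> (x \<otimes> b)) = coset (a \<otimes> a \<otimes> (a \<otimes> a))"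
    by (rule coset_mult_cong) (simp_all add: xb)
  moreover have "coset (x \<otimes> x \<otimes> (b \<otimes> b)) = coset (a \<otimes> b \<otimes> (b \<otimes> b))"
    by (rule coset_mult_cong) (simp_all add: xx)
  ultimately have "coset (a \<otimes> (a \<otimes> a \<otimes> a)) = coset (a \<otimes> (b \<otimes> b \<otimes> b))"
    by (simp add: m_assoc)
  then have "coset (b \<otimes> b \<otimes> b) = coset (a \<otimes> a \<otimes> a)"
    by (simp add: coset_mult_left_cancel)
  moreover have "b \<otimes> (b \<otimes> b \<otimes> b) = b \<otimes> b \<otimes> b \<otimes> b"
    by (simp add: m_assoc)
  ultimately have "b \<otimes> (a \<otimes> a \<otimes> a) = a \<otimes> a \<otimes> a \<otimes> b"
    using coset_commutes[of b "b \<otimes> b \<otimes> b" "a \<otimes> a \<otimes> a"] by simp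
  then show ?thesis using commutes_pow_cancel[of b a 3] by (simp add: numeral_3_eq_3)
qed

text \<open>The ratio is only required to be non-trivial. In contrast to \<open>\<one> \<lless> c\<close> this does not
  refer to the order, so the notion is available for both the order and its converse;
  \<open>two_progressions_positive\<close> recovers a positive ratio.\<close>

definition two_progressions :: "'a set \<Rightarrow> bool"
  where "two_progressions S \<longleftrightarrow> (\<exists>a\<in>carrier G. \<exists>b\<in>carrier G. \<exists>c\<in>carrier G. \<exists>i j.
    S = progression a c i \<union> progression b c j \<and> c \<noteq> \<one> \<and>
    (a \<otimes> b = b \<otimes> a \<otimes> c \<or> b \<otimes> a = a \<otimes> b \<otimes> c))"

lemma progression_mult:
  assumes "a \<in> carrier G" "b \<in> carrier G" "central c"
  shows "progression a c i <#> progression b c j = progression (a \<otimes> b) c (i + j)"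
proof -
  have cc: "c \<in> carrier G" using assms by auto
  have *: "(a \<otimes> c [^] m) \<otimes> (b \<otimes> c [^] n) = a \<otimes> b \<otimes> c [^] (m + n)" for m n :: nat
  proof -
    have "(a \<otimes> c [^] m) \<otimes> (b \<otimes> c [^] n) = (a \<otimes> c [^] m \<otimes> b) \<otimes> c [^] n"
      using assms cc by (simp add: m_assoc)
    also have "a \<otimes> c [^] m \<otimes> b = a \<otimes> b \<otimes> c [^] m"
      using mult_central_move[OF central_pow] assms by simp
    finally show ?thesis using assms cc by (simp add: m_assoc nat_pow_mult)
  qed
  show ?thesis
  proof
    show "progression a c i <#> progression b c j \<subseteq> progression (a \<otimes> b) c (i + j)"
      by (auto simp: set_mult_def progression_def *)
    show "progression (a \<otimes> b) c (i + j) \<subseteq> progression a c i <#> progression b c j"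
    proof
      fix x assume "x \<in> progression (a \<otimes> b) c (i + j)"
      then obtain k where k: "k \<le> i + j" "x = a \<otimes> b \<otimes> c [^] k"
        unfolding progression_def by blast
      have "x = (a \<otimes> c [^] min k i) \<otimes> (b \<otimes> c [^] (k - min k i))"
        using k * by simp
      moreover have "a \<otimes> c [^] min k i \<in> progression a c i" by (simp add: progressionI)
      moreover have "b \<otimes> c [^] (k - min k i) \<in> progression b c j"
        using k by (intro progressionI) simp
      ultimately show "x \<in> progression a c i <#> progression b c j"
        unfolding set_mult_def by blast
    qed
  qed
qed

lemma coset_progression:
  assumes "a \<in> carrier G" "central c" "x \<in> progression a c i" shows "coset x = coset a"
  using assms coset_mult_central central_pow unfolding progression_def by auto

lemma central_if_commutator:
  assumes "a \<in> carrier G" "b \<in> carrier G" "c \<in> carrier G" "a \<otimes> b = b \<otimes> a \<otimes> c"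
  shows "central c"
proof -
  obtain z where z: "central z" "a \<otimes> b = b \<otimes> a \<otimes> z"
    using coset_mult_commute[of b a] coset_eq_iff[of "b \<otimes> a" "a \<otimes> b"] assms by auto
  then have "c = z" using assms by (metis central_carrier m_closed l_cancel)
  then show ?thesis using z by simp
qed

section \<open>One element next to a commuting set\<close>

text \<open>The left and right translates of the progression by \<open>y\<close> are progressions with ratio \<open>d\<close> from \<open>yt\<close>
  and \<open>ty\<close>. So few elements in their union means that they are one step apart, which makes \<open>d\<close>
  a commutator.\<close>

lemma two_progressions_insert:
  assumes "t \<in> carrier G" "y \<in> carrier G" "\<one> \<lless> d" "t \<otimes> d = d \<otimes> t" "y \<otimes> d = d \<otimes> y"
    and "y \<otimes> t \<noteq> t \<otimes> y" "0 < N"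
    and "card ((\<lambda>s. y \<otimes> s) ` progression t d N \<union> (\<lambda>s. s \<otimes> y) ` progression t d N) \<le> N + 2"
  shows "two_progressions (insert y (progression t d N))"
proof -
  have dc: "d \<in> carrier G" "d \<noteq> \<one>" using assms by auto
  have "(\<lambda>s. y \<otimes> s) ` progression t d N = progression (y \<otimes> t) d N"
    using assms dc by (simp add: progression_image image_image m_assoc)
  moreover have "t \<otimes> d [^] n \<otimes> y = t \<otimes> y \<otimes> d [^] n" for n :: nat
    using assms dc commutes_pow[of y d n] by (simp add: m_assoc)
  then have "(\<lambda>s. s \<otimes> y) ` progression t d N = progression (t \<otimes> y) d N"
    by (simp add: progression_image image_image)
  ultimately have "t \<otimes> y = y \<otimes> t \<otimes> d \<or> y \<otimes> t = t \<otimes> y \<otimes> d"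
    using translated_progressions_step[of "y \<otimes> t" "t \<otimes> y" d N] assms by auto
  moreover have "insert y (progression t d N) = progression t d N \<union> progression y d 0"
    using assms by (simp add: progression_def)
  ultimately show ?thesis unfolding two_progressions_def using assms dc by blast
qed

text \<open>Two coincidences between the left and the right translate of the progression give
  \<open>d\<^sup>P y = y d\<^sup>M\<close> with positive exponents. Modulo the centre this reads \<open>d\<^sup>P = d\<^sup>M\<close>, so either \<open>P = M\<close>
  and a power of \<open>d\<close> commutes with \<open>y\<close>, or a power of \<open>d\<close> is central.\<close>

lemma commutes_progression_ratio:
  assumes "t \<in> carrier G" "y \<in> carrier G" "\<one> \<lless> d" "2 \<le> N"
    and "card ((\<lambda>s. y \<otimes> s) ` progression t d N \<union> (\<lambda>s. s \<otimes> y) ` progression t d N) \<le> N + 2"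
  shows "y \<otimes> d = d \<otimes> y"
proof -
  have dc: "d \<in> carrier G" "d \<noteq> \<one>" using assms by auto
  let ?T = "progression t d N"
  let ?L = "(\<lambda>s. y \<otimes> s) ` ?T" and ?Q = "(\<lambda>s. s \<otimes> y) ` ?T"
  have Tc: "?T \<subseteq> carrier G" using progression_closed assms dc by simp
  have cL: "card ?L = N + 1" "card ?Q = N + 1"
    using card_image[of "\<lambda>s. y \<otimes> s" ?T] card_image[of "\<lambda>s. s \<otimes> y" ?T] Tc assms(2)
      card_progression[OF assms(1) dc, of N] by (auto simp: inj_on_def subset_iff)
  have "card (?L \<inter> ?Q) \<ge> 2"
    using card_Un_Int[of ?L ?Q] cL assms by simp
  then obtain z1 z2 where z: "z1 \<in> ?L \<inter> ?Q" "z2 \<in> ?L \<inter> ?Q" "z1 \<noteq> z2"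
    by (metis One_nat_def card_le_Suc0_iff_eq card.infinite not_less_eq_eq numeral_2_eq_2 zero_le_one)
  have key: "y \<otimes> d = d \<otimes> y"
    if e1: "z1 = y \<otimes> (t \<otimes> d [^] n)" "z1 = t \<otimes> d [^] p \<otimes> y"
      and e2: "z2 = y \<otimes> (t \<otimes> d [^] n')" "z2 = t \<otimes> d [^] p' \<otimes> y" and nn: "n < n'"
    for z1 z2 and n p n' p' :: nat
  proof -
    have "z1 \<lless> z2"
      using nn e1(1) e2(1) less_mult_left pow_less_pow_iff[OF assms(3)] assms(1,2) by simp
    then have "d [^] p \<lless> d [^] p'"
      using e1(2) e2(2) mult_right_cancel_less[of y "t \<otimes> d [^] p" "t \<otimes> d [^] p'"]
        mult_left_cancel_less[of t "d [^] p" "d [^] p'"] assms(1,2) dc by simp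
    then have pp: "p < p'" using pow_less_pow_iff[OF assms(3)] by simp
    define M P where "M = n' - n" and "P = p' - p"
    have MP: "0 < M" "0 < P" using nn pp by (auto simp: M_def P_def)
    have "t \<otimes> d [^] p \<otimes> (d [^] P \<otimes> y) = z2"
      using e2(2) pp assms(1,2) dc by (simp add: P_def m_assoc[symmetric]) (simp add: m_assoc nat_pow_mult)
    moreover have "z2 = z1 \<otimes> d [^] M"
      using e1(1) e2(1) nn assms(1,2) dc by (simp add: M_def m_assoc nat_pow_mult)
    ultimately have "t \<otimes> d [^] p \<otimes> (d [^] P \<otimes> y) = t \<otimes> d [^] p \<otimes> (y \<otimes> d [^] M)"
      using e1(2) assms(1,2) dc by (simp add: m_assoc)
    then have dy: "d [^] P \<otimes> y = y \<otimes> d [^] M"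
      using assms(1,2) dc by (metis l_cancel m_closed nat_pow_closed)
    show ?thesis
    proof (cases "M = P")
      case True
      then show ?thesis using commutes_pow_cancel[of y d M] dy MP assms(2) dc by simp
    next
      case False
      have "coset (y \<otimes> d [^] P) = coset (y \<otimes> d [^] M)"
        using coset_mult_commute[of "d [^] P" y] dy assms(2) dc by simp
      then have cc: "coset (d [^] P) = coset (d [^] M)"
        using coset_mult_left_cancel assms(2) dc by simp
      \<comment> \<open>A relation between different powers makes a proper power of \<open>d\<close> central.\<close>
      have *: "central d" if e: "coset (d [^] m) = coset (d [^] k)" and mk: "m < k" for m k :: nat
      proof -
        obtain z where z: "central z" "d [^] k = d [^] m \<otimes> z"
          using e coset_eq_iff[of "d [^] m" "d [^] k"] dc by auto
        moreover have "d [^] k = d [^] m \<otimes> d [^] (k - m)" using mk dc by (simp add: nat_pow_mult)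
        ultimately have "z = d [^] (k - m)" using dc central_carrier[OF z(1)] by (metis l_cancel nat_pow_closed)
        then show ?thesis using central_pow_cancel[of d "k - m"] z dc mk by simp
      qed
      have "central d" using *[of P M] *[of M P] cc False by (metis nat_neq_iff)
      then show ?thesis using central_commutes[of d y] assms(2) by simp
    qed
  qed
  obtain n p n' p' where
    "z1 = y \<otimes> (t \<otimes> d [^] (n::nat))" "z1 = t \<otimes> d [^] (p::nat) \<otimes> y"
    "z2 = y \<otimes> (t \<otimes> d [^] (n'::nat))" "z2 = t \<otimes> d [^] (p'::nat) \<otimes> y"
    using z(1,2) unfolding progression_def by blast
  moreover have "n \<noteq> n'" using z(3) calculation by blast
  ultimately show ?thesis using key[of z1 n p z2 n' p'] key[of z2 n' p' z1 n p] by (metis nat_neq_iff)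
qed

text \<open>The lower bounds \<open>2 card T - 1\<close> and \<open>card T + 1\<close> for the two main parts of the square add up to
  the assumed size, so both are attained.\<close>

lemma two_progressions_if_commuting_part:
  assumes T: "finite T" "T \<subseteq> carrier G" and y: "y \<in> carrier G"
    and comm: "\<And>s t. \<lbrakk>s \<in> T; t \<in> T\<rbrakk> \<Longrightarrow> s \<otimes> t = t \<otimes> s"
    and t: "t \<in> T" "y \<otimes> t \<noteq> t \<otimes> y"
    and card: "3 \<le> card T" "card (insert y T <#> insert y T) \<le> 3 * card T + 1"
  shows "two_progressions (insert y T)"
proof -
  note split = card_square_insert_commuting[OF T y comm t]
  have sq: "2 * card T \<le> card (T <#> T) + 1" using card_square_ge[OF T(1) _ T(2)] t by blast
  note two = card_two_sided_ge[OF T y t]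
  have "card (T <#> T) + 1 \<le> 2 * card T" using split two card by linarith
  then obtain a d where ad: "a \<in> carrier G" "\<one> \<lless> d" "a \<otimes> d = d \<otimes> a"
    and Tp: "T = progression a d (card T - 1)"
    using progression_if_small_square[OF T _ _ comm] card(1) by (metis One_nat_def Suc_leD numeral_2_eq_2 numeral_3_eq_3)
  define N where "N = card T - 1"
  have N: "2 \<le> N" "card T = N + 1" using card(1) by (auto simp: N_def)
  have Tp: "T = progression a d N" using Tp N_def by simp
  have U: "card ((\<lambda>s. y \<otimes> s) ` progression a d N \<union> (\<lambda>s. s \<otimes> y) ` progression a d N) \<le> N + 2"
    using split sq card(2) N unfolding Tp[symmetric] by linarith
  have yd: "y \<otimes> d = d \<otimes> y" using commutes_progression_ratio[OF ad(1) y ad(2) N(1) U] .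
  have dc: "d \<in> carrier G" using ad by auto
  have ya: "y \<otimes> a \<noteq> a \<otimes> y"
  proof
    assume ya: "y \<otimes> a = a \<otimes> y"
    obtain n where "t = a \<otimes> d [^] (n::nat)" using t Tp unfolding progression_def by blast
    then show False using commutes_mult[of y a "d [^] n"] commutes_pow[of y d n] ya yd y ad(1) dc t by simp
  qed
  show ?thesis unfolding Tp
    by (rule two_progressions_insert) (use ad y yd ya N U in auto)
qed

text \<open>Two congruent elements form a progression of length two with a central ratio. Their own
  products number at least three, which leaves at most three products with exactly one factor \<open>y\<close>.\<close>

lemma two_progressions_if_congruent_pair:
  assumes c: "p \<in> carrier G" "q \<in> carrier G" "y \<in> carrier G"
    and pq: "p \<noteq> q" "coset p = coset q" and nc: "y \<otimes> p \<noteq> p \<otimes> y"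
    and card: "card ({y, p, q} <#> {y, p, q}) \<le> 7"
  shows "two_progressions {y, p, q}"
proof -
  have key: "two_progressions {y, p, q}"
    if l: "p \<lless> q" and pq: "p \<noteq> q" "coset p = coset q" and nc: "y \<otimes> p \<noteq> p \<otimes> y"
      and card: "card ({y, p, q} <#> {y, p, q}) \<le> 7" for p q
  proof -
    have c: "p \<in> carrier G" "q \<in> carrier G" "y \<in> carrier G" using l assms by auto
    obtain d where d: "central d" "q = p \<otimes> d" using coset_eq_iff c pq by metis
    have dc: "d \<in> carrier G" using d by auto
    have d1: "\<one> \<lless> d" using mult_left_cancel_less[of p \<one> d] l d c dc by simp
    have pr: "{p, q} = progression p d 1"
      using d(2) c(1) dc unfolding progression_image by (auto simp: atMost_Suc)
    have comm: "s \<otimes> t = t \<otimes> s" if "s \<in> {p, q}" "t \<in> {p, q}" for s t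
      using that coset_eq_commutes pq c by (metis empty_iff insert_iff)
    have "card ({y, p, q} <#> {y, p, q}) = card ({p, q} <#> {p, q}) +
        card ((\<lambda>t. y \<otimes> t) ` {p, q} \<union> (\<lambda>t. t \<otimes> y) ` {p, q}) + 1"
      using card_square_insert_commuting[of "{p, q}" y p] comm c nc by simp
    moreover have "2 * card {p, q} \<le> card ({p, q} <#> {p, q}) + 1"
      using card_square_ge[of "{p, q}"] c by simp
    ultimately have "card ((\<lambda>t. y \<otimes> t) ` {p, q} \<union> (\<lambda>t. t \<otimes> y) ` {p, q}) \<le> 1 + 2"
      using card pq(1) by simp
    then have "two_progressions (insert y (progression p d 1))"
      unfolding pr using two_progressions_insert[of p y d 1] c d1 nc central_commutes[OF d(1)] by simp
    then show ?thesis unfolding pr .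
  qed
  have nc': "y \<otimes> q \<noteq> q \<otimes> y" using coset_commutes[of y q p] c pq nc by auto
  consider "p \<lless> q" | "q \<lless> p" using less_linear c pq by blast
  then show ?thesis
    using key[of p q] key[of q p] pq nc nc' card by cases (auto simp: insert_commute)
qed

section \<open>Elements outside the cosets of two progressions\<close>

lemma coset_mult_interchange:
  assumes "p \<in> carrier G" "q \<in> carrier G" "r \<in> carrier G" "s \<in> carrier G"
  shows "coset (p \<otimes> q \<otimes> (r \<otimes> s)) = coset (p \<otimes> r \<otimes> (q \<otimes> s))"
proof -
  have "coset (q \<otimes> r \<otimes> s) = coset (r \<otimes> q \<otimes> s)"
    using coset_mult_commute[of q r] assms by (simp add: coset_mult_right_cancel)
  then have "coset (p \<otimes> (q \<otimes> r \<otimes> s)) = coset (p \<otimes> (r \<otimes> q \<otimes> s))"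
    using assms by (simp add: coset_mult_left_cancel)
  then show ?thesis using assms by (simp add: m_assoc)
qed

lemma set_mult_Un: "(A \<union> B) <#> (A \<union> B) = (A <#> A) \<union> (B <#> B) \<union> (A <#> B) \<union> (B <#> A)"
  by (auto simp: set_mult_def)

lemma square_of_progressions:
  assumes "a \<in> carrier G" "b \<in> carrier G" "central c"
  shows "(progression a c i \<union> progression b c j) <#> (progression a c i \<union> progression b c j)
    = progression (a \<otimes> a) c (2 * i) \<union> progression (b \<otimes> b) c (2 * j)
      \<union> progression (a \<otimes> b) c (i + j) \<union> progression (b \<otimes> a) c (i + j)"
  unfolding set_mult_Un using assms by (simp add: progression_mult mult_2 add.commute)

lemma progression_Un_shift:
  assumes "h \<in> carrier G" "c \<in> carrier G"
  shows "progression h c n \<union> progression (h \<otimes> c) c n = progression h c (Suc n)"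
proof -
  have "h \<otimes> c \<otimes> c [^] m = h \<otimes> c [^] Suc m" for m :: nat
    using assms by (metis m_assoc nat_pow_closed nat_pow_Suc2)
  then have "progression (h \<otimes> c) c n = (\<lambda>m. h \<otimes> c [^] m) ` (Suc ` {..n})"
    by (simp only: progression_image image_image)
  moreover have "{..n} \<union> Suc ` {..n} = {..Suc n}"
  proof (rule Set.set_eqI)
    fix k show "k \<in> {..n} \<union> Suc ` {..n} \<longleftrightarrow> k \<in> {..Suc n}" by (cases k) auto
  qed
  ultimately show ?thesis by (metis progression_image image_Un)
qed

text \<open>Here \<open>h\<close> is that one of \<open>ab\<close> and \<open>ba\<close> from which the other is obtained by multiplication with \<open>c\<close>.
  With \<open>h\<close> the two forms of the commutator relation need not be treated separately.\<close>

lemma square_of_two_progressions: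
  assumes "a \<in> carrier G" "b \<in> carrier G" "central c"
    and "a \<otimes> b = h \<and> b \<otimes> a = h \<otimes> c \<or> b \<otimes> a = h \<and> a \<otimes> b = h \<otimes> c"
  shows "(progression a c i \<union> progression b c j) <#> (progression a c i \<union> progression b c j)
    = progression (a \<otimes> a) c (2 * i) \<union> progression (b \<otimes> b) c (2 * j) \<union> progression h c (Suc (i + j))"
proof -
  have h: "h \<in> carrier G" using assms by auto
  have "progression (a \<otimes> b) c (i + j) \<union> progression (b \<otimes> a) c (i + j) = progression h c (Suc (i + j))"
    using assms(4) progression_Un_shift[OF h central_carrier[OF assms(3)], of "i + j"]
    by (metis Un_commute)
  then show ?thesis using square_of_progressions[OF assms(1-3)] by (metis sup_assoc)
qed

lemma product_cosets_distinct:
  assumes "a \<in> carrier G" "b \<in> carrier G" "a \<otimes> b \<noteq> b \<otimes> a"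
  shows "coset (a \<otimes> a) \<noteq> coset (b \<otimes> b)" "coset (a \<otimes> a) \<noteq> coset (a \<otimes> b)"
    "coset (b \<otimes> b) \<noteq> coset (a \<otimes> b)" "coset a \<noteq> coset b"
proof -
  show ab: "coset a \<noteq> coset b" using coset_eq_commutes assms by blast
  show "coset (a \<otimes> a) \<noteq> coset (b \<otimes> b)" using ab coset_square_cancel assms by blast
  show "coset (a \<otimes> a) \<noteq> coset (a \<otimes> b)" using ab coset_mult_left_cancel assms by blast
  show "coset (b \<otimes> b) \<noteq> coset (a \<otimes> b)" using ab coset_mult_right_cancel assms by metis
qed

lemma card_square_two_progressions:
  assumes "a \<in> carrier G" "b \<in> carrier G" "central c" "c \<noteq> \<one>"
    and "a \<otimes> b = b \<otimes> a \<otimes> c \<or> b \<otimes> a = a \<otimes> b \<otimes> c"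
  shows "card ((progression a c i \<union> progression b c j) <#> (progression a c i \<union> progression b c j))
    = 3 * (i + j) + 4"
proof -
  have cc: "c \<in> carrier G" using assms by auto
  obtain h where h: "a \<otimes> b = h \<and> b \<otimes> a = h \<otimes> c \<or> b \<otimes> a = h \<and> a \<otimes> b = h \<otimes> c"
    using assms(5) by blast
  have hc: "h \<in> carrier G" using h assms by auto
  have "h \<noteq> h \<otimes> c" using hc cc assms(4) by simp
  then have nc: "a \<otimes> b \<noteq> b \<otimes> a" using h by metis
  have hab: "coset h = coset (a \<otimes> b)" using h coset_mult_commute[OF assms(1,2)] by metis
  note d = product_cosets_distinct[OF assms(1,2) nc]
  let ?A = "progression (a \<otimes> a) c (2 * i)" and ?B = "progression (b \<otimes> b) c (2 * j)"
    and ?H = "progression h c (Suc (i + j))"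
  have cA: "coset u = coset (a \<otimes> a)" if "u \<in> ?A" for u
    using that coset_progression assms(1,3) by blast
  have cB: "coset u = coset (b \<otimes> b)" if "u \<in> ?B" for u
    using that coset_progression assms(2,3) by blast
  have cH: "coset u = coset (a \<otimes> b)" if "u \<in> ?H" for u
    using that coset_progression hc hab assms(3) by metis
  have "?A \<inter> ?B = {}" 
  proof (rule ccontr)
    assume "?A \<inter> ?B \<noteq> {}"
    then obtain u where "u \<in> ?A" "u \<in> ?B" by blast
    then show False using cA[of u] cB[of u] d(1) by simp
  qed
  moreover have "(?A \<union> ?B) \<inter> ?H = {}" 
  proof (rule ccontr)
    assume "(?A \<union> ?B) \<inter> ?H \<noteq> {}"
    then obtain u where "u \<in> ?A \<or> u \<in> ?B" "u \<in> ?H" by blast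
    then show False using cA[of u] cB[of u] cH[of u] d(2,3) by auto
  qed
  ultimately show ?thesis
    unfolding square_of_two_progressions[OF assms(1-3) h]
    using card_progression[OF _ cc assms(4)] assms(1,2) hc by (simp add: card_Un_disjoint)
qed

text \<open>In additive notation modulo the centre, the products of \<open>x\<close> with the \<open>a\<close>-progression are new
  because \<open>x + a\<close> differs from \<open>2a\<close>, \<open>a + b\<close> and \<open>2b\<close>. If \<open>x + b\<close> differs from \<open>2a\<close>, the products
  with the \<open>b\<close>-progression are new as well. That gives \<open>i + j + 2 \<ge> 3\<close> products, and a fourth is
  \<open>xx\<close>, unless \<open>2x = a + b\<close>, when \<open>x\<close> does not commute with \<open>a\<close> and the right translate
  adds a product.

  If \<open>x + b = 2a\<close>, the element \<open>x\<close> commutes with neither \<open>a\<close> nor \<open>b\<close>, and \<open>xx\<close> is new by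
  \<open>coset_no_cubic_relation\<close>. Together with the at least \<open>i + 2\<close> products of \<open>x\<close> and the
  \<open>a\<close>-progression this suffices for \<open>i \<ge> 1\<close>. For \<open>i = 0\<close> the only old product in the coset of
  \<open>aa\<close> is \<open>aa\<close> itself, so that one of \<open>xb\<close> and \<open>bx\<close> is new.\<close>

lemma four_new_products_if_xa_apart:
  assumes c: "a \<in> carrier G" "b \<in> carrier G" "x \<in> carrier G" "central c" "c \<noteq> \<one>"
    and nc: "a \<otimes> b \<noteq> b \<otimes> a" and x: "coset x \<noteq> coset a" "coset x \<noteq> coset b"
    and xa_bb: "coset (x \<otimes> a) \<noteq> coset (b \<otimes> b)" and ij: "1 \<le> i + j"
    and T: "T = progression a c i \<union> progression b c j"
  shows "4 \<le> card ((insert x (T) <#> insert x (T)) - (T <#> T))"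
proof -
  let ?P = "progression a c i" and ?Q = "progression b c j"
  let ?D = "(insert x T <#> insert x T) - (T <#> T)"
  have cc: "c \<in> carrier G" using c by auto
  note d = product_cosets_distinct[OF c(1,2) nc]
  have Tc: "T \<subseteq> carrier G" using progression_closed c cc unfolding T by auto
  have fT: "finite T" unfolding T by simp
  have finD: "finite ?D" using finite_set_mult fT by simp
  have ba: "coset (b \<otimes> a) = coset (a \<otimes> b)" using coset_mult_commute c by simp
  have sq: "T <#> T = progression (a \<otimes> a) c (2 * i) \<union> progression (b \<otimes> b) c (2 * j)
      \<union> progression (a \<otimes> b) c (i + j) \<union> progression (b \<otimes> a) c (i + j)"
    unfolding T using square_of_progressions c by simp
  have old: "coset u = coset (a \<otimes> a) \<or> coset u = coset (b \<otimes> b) \<or> coset u = coset (a \<otimes> b)"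
    if "u \<in> T <#> T" for u
    using that unfolding sq
    using coset_progression[OF _ c(4)] c(1,2) ba by (metis Un_iff m_closed)
  have coset_P: "coset t = coset a" if "t \<in> ?P" for t
    using that coset_progression c by blast
  have coset_Q: "coset t = coset b" if "t \<in> ?Q" for t
    using that coset_progression c by blast
  have coset_x: "coset (x \<otimes> t) = coset (x \<otimes> s)" "coset (t \<otimes> x) = coset (x \<otimes> s)"
    if "coset t = coset s" "t \<in> carrier G" "s \<in> carrier G" for t s
    using that c(3) coset_mult_left_cancel coset_mult_commute by metis+
  have new_xa: "coset (x \<otimes> a) \<noteq> coset (a \<otimes> a)" "coset (x \<otimes> a) \<noteq> coset (a \<otimes> b)"
    using x c ba coset_mult_right_cancel by metis+
  have xP: "coset u = coset (x \<otimes> a)" if "u \<in> (\<lambda>t. x \<otimes> t) ` ?P \<union> (\<lambda>t. t \<otimes> x) ` ?P" for u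
  proof -
    obtain t where t: "t \<in> ?P" "u = x \<otimes> t \<or> u = t \<otimes> x" using \<open>u \<in> _\<close> by blast
    have "t \<in> carrier G" using t(1) progression_closed c(1) cc by blast
    then show ?thesis using coset_x[OF coset_P[OF t(1)] _ c(1)] t(2) by auto
  qed
  have D_P: "(\<lambda>t. x \<otimes> t) ` ?P \<union> (\<lambda>t. t \<otimes> x) ` ?P \<subseteq> ?D"
  proof
    fix u assume u: "u \<in> (\<lambda>t. x \<otimes> t) ` ?P \<union> (\<lambda>t. t \<otimes> x) ` ?P"
    then have "u \<in> insert x T <#> insert x T" unfolding T set_mult_def by blast
    moreover have "u \<notin> T <#> T" using old[of u] xP[OF u] new_xa xa_bb by metis
    ultimately show "u \<in> ?D" by blast
  qed
  have xx: "x \<otimes> x \<in> insert x T <#> insert x T" unfolding set_mult_def by blast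
  have xx_d: "coset (x \<otimes> x) \<noteq> coset (a \<otimes> a)" "coset (x \<otimes> x) \<noteq> coset (b \<otimes> b)"
    using coset_square_cancel x c by blast+
  have xx_x: "coset (x \<otimes> x) \<noteq> coset (x \<otimes> a)" "coset (x \<otimes> x) \<noteq> coset (x \<otimes> b)"
    using coset_mult_left_cancel x c by blast+
  have aP: "a \<in> ?P" using progressionI[of 0 i a c] c cc by simp
  have bT: "b \<in> T" using progressionI[of 0 j b c] c cc T by simp
  have cP: "card ?P = Suc i" using card_progression c cc by blast
  have PcG: "?P \<subseteq> carrier G" "finite ?P" using Tc T by auto
  show ?thesis
  proof (cases "coset (x \<otimes> b) = coset (a \<otimes> a)")
    case True
    have xa: "x \<otimes> a \<noteq> a \<otimes> x"
    proof
      assume e: "x \<otimes> a = a \<otimes> x"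
      have "a \<otimes> b = b \<otimes> a"
        using coset_commutes_four[of a a x b a] True e c by simp
      then show False using nc by simp
    qed
    have xb: "x \<otimes> b \<noteq> b \<otimes> x"
    proof
      assume e: "x \<otimes> b = b \<otimes> x"
      then have "b \<otimes> (x \<otimes> b) = x \<otimes> b \<otimes> b" using commutes_mult[of b x b] c by simp
      then have "b \<otimes> (a \<otimes> a) = a \<otimes> a \<otimes> b"
        using coset_commutes[of b "x \<otimes> b" "a \<otimes> a"] True c by simp
      then show False using commutes_square_cancel[of b a] nc c by simp
    qed
    have "coset (x \<otimes> x) \<noteq> coset (a \<otimes> b)"
      using coset_no_cubic_relation[of a b x] True nc c by blast
    then have xxD: "x \<otimes> x \<in> ?D" using xx old[of "x \<otimes> x"] xx_d by blast
    let ?U = "(\<lambda>t. x \<otimes> t) ` ?P \<union> (\<lambda>t. t \<otimes> x) ` ?P"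
    have cU: "card ?P + 1 \<le> card ?U"
      using card_two_sided_ge[OF PcG(2,1) c(3) aP] xa by blast
    have xxU: "x \<otimes> x \<notin> ?U" using xP xx_x by metis
    have fU: "finite ?U" using PcG by simp
    show ?thesis
    proof (cases "i = 0")
      case False
      have "insert (x \<otimes> x) ?U \<subseteq> ?D" using D_P xxD by blast
      from card_mono[OF finD this] show ?thesis using cU xxU fU cP False by simp
    next
      case True
      \<comment> \<open>As \<open>xb \<noteq> bx\<close>, at least one of them differs from \<open>aa\<close>.\<close>
      define e where "e = (if x \<otimes> b = a \<otimes> a then b \<otimes> x else x \<otimes> b)"
      have e1: "e \<noteq> a \<otimes> a" using xb unfolding e_def by auto
      have e2: "coset e = coset (x \<otimes> b)" using coset_mult_commute c unfolding e_def by auto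
      have "e \<notin> T <#> T"
      proof
        assume "e \<in> T <#> T"
        moreover have "coset e \<noteq> coset (b \<otimes> b)" "coset e \<noteq> coset (a \<otimes> b)"
          using e2 d \<open>coset (x \<otimes> b) = coset (a \<otimes> a)\<close> by simp_all
        ultimately have "e \<in> progression (a \<otimes> a) c (2 * i)"
          unfolding sq using coset_progression[OF _ c(4)] c(1,2) ba by (metis Un_iff m_closed)
        then show False using True e1 c cc unfolding progression_def by auto
      qed
      moreover have "e \<in> insert x T <#> insert x T"
        using bT unfolding e_def set_mult_def by auto
      ultimately have "insert e (insert (x \<otimes> x) ?U) \<subseteq> ?D" using D_P xxD by blast
      from card_mono[OF finD this]
      have "card (insert e (insert (x \<otimes> x) ?U)) \<le> card ?D" .
      moreover have "e \<notin> ?U" using xP e2 d(4) coset_mult_left_cancel c by metis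
      moreover have "e \<noteq> x \<otimes> x" using e2 xx_x by metis
      ultimately show ?thesis using cU xxU fU cP by simp
    qed
  next
    case False
    have new_xb: "coset (x \<otimes> b) \<noteq> coset (b \<otimes> b)" "coset (x \<otimes> b) \<noteq> coset (a \<otimes> b)"
      using x c coset_mult_right_cancel by metis+
    have xT: "coset u = coset (x \<otimes> a) \<or> coset u = coset (x \<otimes> b)"
      if "u \<in> (\<lambda>t. x \<otimes> t) ` T \<union> (\<lambda>t. t \<otimes> x) ` T" for u
    proof -
      obtain t where t: "t \<in> T" "u = x \<otimes> t \<or> u = t \<otimes> x" using \<open>u \<in> _\<close> by blast
      have tc: "t \<in> carrier G" using t Tc by blast
      have "coset t = coset a \<or> coset t = coset b" using t(1) coset_P coset_Q unfolding T by blast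
      then show ?thesis using coset_x[of t a] coset_x[of t b] t(2) tc c(1,2) by blast
    qed
    have D_T: "(\<lambda>t. x \<otimes> t) ` T \<union> (\<lambda>t. t \<otimes> x) ` T \<subseteq> ?D"
    proof
      fix u assume u: "u \<in> (\<lambda>t. x \<otimes> t) ` T \<union> (\<lambda>t. t \<otimes> x) ` T"
      then have "u \<in> insert x T <#> insert x T" unfolding set_mult_def by blast
      moreover have "u \<notin> T <#> T" using old[of u] xT[OF u] new_xa xa_bb new_xb False by metis
      ultimately show "u \<in> ?D" by blast
    qed
    have PQ: "?P \<inter> ?Q = {}" 
    proof (rule ccontr)
      assume "?P \<inter> ?Q \<noteq> {}"
      then obtain u where "u \<in> ?P" "u \<in> ?Q" by blast
      then show False using coset_P[of u] coset_Q[of u] d(4) by simp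
    qed
    have cT: "card T = i + j + 2"
      unfolding T using PQ card_progression[OF _ cc c(5)] c(1,2) by (simp add: card_Un_disjoint)
    show ?thesis
    proof (cases "coset (x \<otimes> x) = coset (a \<otimes> b)")
      case True
      have xa: "x \<otimes> a \<noteq> a \<otimes> x"
      proof
        assume e: "x \<otimes> a = a \<otimes> x"
        have "a \<otimes> b = b \<otimes> a"
          using coset_commutes_four[OF c(3) c(3) c(1) c(2) c(1) True] e by metis
        then show False using nc by simp
      qed
      have "a \<in> T" using aP T by simp
      have "card T + 1 \<le> card ((\<lambda>t. x \<otimes> t) ` T \<union> (\<lambda>t. t \<otimes> x) ` T)"
        using card_two_sided_ge[OF fT Tc c(3) \<open>a \<in> T\<close> xa] .
      also have "\<dots> \<le> card ?D" by (rule card_mono[OF finD D_T])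
      finally show ?thesis using cT ij by linarith
    next
      case False
      then have xxD: "x \<otimes> x \<in> ?D" using xx old[of "x \<otimes> x"] xx_d by blast
      have "insert (x \<otimes> x) ((\<lambda>t. x \<otimes> t) ` T) \<subseteq> ?D" using xxD D_T by blast
      from card_mono[OF finD this]
      have "card (insert (x \<otimes> x) ((\<lambda>t. x \<otimes> t) ` T)) \<le> card ?D" .
      moreover have "x \<otimes> x \<notin> (\<lambda>t. x \<otimes> t) ` T" using xT xx_x by blast
      moreover have "card ((\<lambda>t. x \<otimes> t) ` T) = card T"
        using Tc c(3) by (intro card_image) (auto simp: inj_on_def subset_iff)
      ultimately show ?thesis using cT ij fT by simp
    qed
  qed
qed

text \<open>Exchanging the progressions removes the condition \<open>x + a \<noteq> 2b\<close>, because \<open>x + a = 2b\<close> and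
  \<open>x + b = 2a\<close> cannot hold together: their sum gives \<open>2x = a + b\<close>.\<close>

lemma four_new_products:
  assumes c: "a \<in> carrier G" "b \<in> carrier G" "x \<in> carrier G" "central c" "c \<noteq> \<one>"
    and nc: "a \<otimes> b \<noteq> b \<otimes> a" and x: "coset x \<noteq> coset a" "coset x \<noteq> coset b"
    and ij: "1 \<le> i + j" and T: "T = progression a c i \<union> progression b c j"
  shows "4 \<le> card ((insert x T <#> insert x T) - (T <#> T))"
proof (cases "coset (x \<otimes> a) = coset (b \<otimes> b)")
  case False
  then show ?thesis using four_new_products_if_xa_apart[OF c nc x _ ij T] by blast
next
  case True
  have "coset (x \<otimes> b) \<noteq> coset (a \<otimes> a)"
  proof
    assume xb: "coset (x \<otimes> b) = coset (a \<otimes> a)"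
    have "coset (x \<otimes> a \<otimes> (x \<otimes> b)) = coset (b \<otimes> b \<otimes> (a \<otimes> a))"
      using coset_mult_cong[of "x \<otimes> a" "b \<otimes> b" "x \<otimes> b" "a \<otimes> a"] True xb c by simp
    also have "\<dots> = coset (a \<otimes> b \<otimes> (a \<otimes> b))"
      using coset_mult_commute[of "b \<otimes> b" "a \<otimes> a"] coset_mult_interchange[of a a b b] c by simp
    finally have "coset (x \<otimes> x \<otimes> (a \<otimes> b)) = coset (a \<otimes> b \<otimes> (a \<otimes> b))"
      using coset_mult_interchange[of x a x b] c by simp
    then have "coset (x \<otimes> x) = coset (a \<otimes> b)"
      using coset_mult_right_cancel[of "a \<otimes> b" "x \<otimes> x" "a \<otimes> b"] c by simp
    then show False using coset_no_cubic_relation[of a b x] xb nc c by blast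
  qed
  moreover have "1 \<le> j + i" using ij by simp
  ultimately show ?thesis
    using four_new_products_if_xa_apart[OF c(2,1,3-5) nc[symmetric] x(2,1)] T
    by (metis Un_commute)
qed

section \<open>Extending two progressions by a greatest element\<close>

text \<open>Reading a progression backwards inverts the ratio.\<close>

lemma progression_reverse:
  assumes "a \<in> carrier G" "c \<in> carrier G"
  shows "progression (a \<otimes> c [^] i) (inv c) i = progression a c i"
proof -
  have *: "a \<otimes> c [^] i \<otimes> inv c [^] n = a \<otimes> c [^] (i - n)" if "n \<le> i" for n
  proof -
    have "c [^] i = c [^] (i - n) \<otimes> c [^] n" using that assms by (simp add: nat_pow_mult)
    moreover have "c [^] n \<otimes> inv c [^] n = \<one>" using assms by (simp add: nat_pow_inv)
    ultimately show ?thesis using assms by (simp add: m_assoc)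
  qed
  show ?thesis
  proof
    show "progression (a \<otimes> c [^] i) (inv c) i \<subseteq> progression a c i"
      using * unfolding progression_def by auto
    show "progression a c i \<subseteq> progression (a \<otimes> c [^] i) (inv c) i"
    proof
      fix x assume "x \<in> progression a c i"
      then obtain n where n: "n \<le> i" "x = a \<otimes> c [^] n" unfolding progression_def by blast
      then have "x = a \<otimes> c [^] i \<otimes> inv c [^] (i - n)" using *[of "i - n"] by simp
      then show "x \<in> progression (a \<otimes> c [^] i) (inv c) i" using n by (simp add: progressionI)
    qed
  qed
qed

lemma two_progressions_central:
  assumes "a \<in> carrier G" "b \<in> carrier G" "c \<in> carrier G"
    and "a \<otimes> b = b \<otimes> a \<otimes> c \<or> b \<otimes> a = a \<otimes> b \<otimes> c"
  shows "central c"
  using assms central_if_commutator by blast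

lemma two_progressions_positive:
  assumes "two_progressions S"
  obtains a b c i j where "a \<in> carrier G" "b \<in> carrier G" "central c" "\<one> \<lless> c"
    "S = progression a c i \<union> progression b c j"
    "a \<otimes> b = b \<otimes> a \<otimes> c \<or> b \<otimes> a = a \<otimes> b \<otimes> c"
proof -
  obtain a b c i j where c: "a \<in> carrier G" "b \<in> carrier G" "c \<in> carrier G" "c \<noteq> \<one>"
    and S: "S = progression a c i \<union> progression b c j"
    and rel: "a \<otimes> b = b \<otimes> a \<otimes> c \<or> b \<otimes> a = a \<otimes> b \<otimes> c"
    using assms unfolding two_progressions_def by blast
  have cen: "central c" using two_progressions_central c rel by blast
  consider "\<one> \<lless> c" | "c \<lless> \<one>" using less_linear c by blast
  then show thesis
  proof cases
    case 1
    then show thesis using that c cen S rel by blast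
  next
    case 2
    \<comment> \<open>Reversing both progressions multiplies \<open>ab\<close> and \<open>ba\<close> by the same central element and turns
      \<open>c\<close> into its inverse, so the two forms of the commutator relation change places.\<close>
    let ?a = "a \<otimes> c [^] i" and ?b = "b \<otimes> c [^] j"
    have pos: "\<one> \<lless> inv c" using less_mult_left[OF 2, of "inv c"] c by simp
    have S': "S = progression ?a (inv c) i \<union> progression ?b (inv c) j"
      using S progression_reverse c by simp
    have mv: "(u \<otimes> c [^] k) \<otimes> (v \<otimes> c [^] l) = u \<otimes> v \<otimes> c [^] (k + l)"
      if "u \<in> carrier G" "v \<in> carrier G" for u v and k l :: nat
    proof -
      have "(u \<otimes> c [^] k) \<otimes> (v \<otimes> c [^] l) = (u \<otimes> c [^] k \<otimes> v) \<otimes> c [^] l"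
        using that c by (simp add: m_assoc)
      also have "u \<otimes> c [^] k \<otimes> v = u \<otimes> v \<otimes> c [^] k"
        using mult_central_move[OF central_pow[OF cen]] that by simp
      finally show ?thesis using that c by (simp add: m_assoc nat_pow_mult)
    qed
    have flip: "u = v \<otimes> inv c" if "v = u \<otimes> c" "u \<in> carrier G" for u v
      using that c by (simp add: m_assoc)
    have shift: "u \<otimes> c \<otimes> c [^] (i + j) = u \<otimes> c [^] (i + j) \<otimes> c" if "u \<in> carrier G" for u
      using mult_central_move[OF cen, of u "c [^] (i + j)"] that c by simp
    have "?b \<otimes> ?a = ?a \<otimes> ?b \<otimes> inv c \<or> ?a \<otimes> ?b = ?b \<otimes> ?a \<otimes> inv c"
    proof -
      have e: "?a \<otimes> ?b = a \<otimes> b \<otimes> c [^] (i + j)" "?b \<otimes> ?a = b \<otimes> a \<otimes> c [^] (i + j)"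
        using mv[of a b i j] mv[of b a j i] c by (simp_all add: add.commute)
      have "?a \<otimes> ?b = ?b \<otimes> ?a \<otimes> c \<or> ?b \<otimes> ?a = ?a \<otimes> ?b \<otimes> c"
        using rel shift[of "b \<otimes> a"] shift[of "a \<otimes> b"] c unfolding e by auto
      then show ?thesis using flip[of "?a \<otimes> ?b" "?b \<otimes> ?a"] flip[of "?b \<otimes> ?a" "?a \<otimes> ?b"] c by auto
    qed
    then show thesis
      by (intro that[OF _ _ central_inv[OF cen] pos S']) (use c in auto)
  qed
qed

lemma card_ge_4I:
  "\<lbrakk>finite A; {u, v, w, e} \<subseteq> A; u \<noteq> v; u \<noteq> w; v \<noteq> w; e \<noteq> u; e \<noteq> v; e \<noteq> w\<rbrakk> \<Longrightarrow> 4 \<le> card A"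
  using card_mono[of A "{e, u, v, w}"] by auto

text \<open>Write \<open>x = az\<close> with central \<open>z\<close>; then \<open>z\<close> exceeds \<open>c\<^sup>i\<close>. The products \<open>xx\<close> and \<open>x ac\<^sup>i\<close> are above all
  old ones in the coset of \<open>aa\<close>, and \<open>h z c\<^sup>j\<^sup>+\<^sup>1\<close> is above all old ones in the coset of \<open>ab\<close>.
  These are three new products, so \<open>h z c\<^sup>j\<close> must be an old one. It is greater than
  \<open>h c\<^sup>i\<^sup>+\<^sup>j\<close>, which leaves only the last old product \<open>h c\<^sup>i\<^sup>+\<^sup>j\<^sup>+\<^sup>1\<close>.\<close>

lemma adjoin_same_coset:
  fixes i j :: nat
  assumes c: "a \<in> carrier G" "b \<in> carrier G" "x \<in> carrier G" "central c" "\<one> \<lless> c"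
    and rel: "a \<otimes> b = b \<otimes> a \<otimes> c \<or> b \<otimes> a = a \<otimes> b \<otimes> c"
    and T: "T = progression a c i \<union> progression b c j"
    and gr: "\<And>t. t \<in> T \<Longrightarrow> t \<lless> x" and cos: "coset x = coset a"
    and card: "card ((insert x T <#> insert x T) - (T <#> T)) \<le> 3"
  shows "x = a \<otimes> c [^] Suc i"
proof -
  let ?D = "(insert x T <#> insert x T) - (T <#> T)"
  have cc: "c \<in> carrier G" "c \<noteq> \<one>" using c by auto
  have finD: "finite ?D" using finite_set_mult T by simp
  obtain z where z: "central z" "x = a \<otimes> z" using coset_eq_iff[of a x] c cos by auto
  have zc: "z \<in> carrier G" using z by auto
  obtain h where h: "a \<otimes> b = h \<and> b \<otimes> a = h \<otimes> c \<or> b \<otimes> a = h \<and> a \<otimes> b = h \<otimes> c"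
    using rel by blast
  have hc: "h \<in> carrier G" using h c by auto
  have "h \<noteq> h \<otimes> c" using hc cc by simp
  then have nc: "a \<otimes> b \<noteq> b \<otimes> a" using h by metis
  have hab: "coset h = coset (a \<otimes> b)" using h coset_mult_commute[OF c(1,2)] by metis
  note d = product_cosets_distinct[OF c(1,2) nc]
  have sq: "T <#> T = progression (a \<otimes> a) c (2 * i) \<union> progression (b \<otimes> b) c (2 * j)
      \<union> progression h c (Suc (i + j))"
    unfolding T using square_of_two_progressions[OF c(1,2,4) h] .
  have aa: "a \<otimes> a \<in> carrier G" "b \<otimes> b \<in> carrier G" using c by auto
  have old_aa: "\<exists>n\<le>2 * i. u = a \<otimes> a \<otimes> c [^] n"
    if u: "u \<in> T <#> T" and cu: "coset u = coset (a \<otimes> a)" for u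
  proof -
    have "u \<notin> progression (b \<otimes> b) c (2 * j)" using coset_progression[OF aa(2) c(4)] cu d(1) by metis
    moreover have "u \<notin> progression h c (Suc (i + j))"
      using coset_progression[OF hc c(4)] cu hab d(2) by metis
    ultimately show ?thesis using u unfolding sq progression_def by blast
  qed
  have old_h: "\<exists>n\<le>Suc (i + j). u = h \<otimes> c [^] n"
    if u: "u \<in> T <#> T" and cu: "coset u = coset h" for u
  proof -
    have "u \<notin> progression (b \<otimes> b) c (2 * j)"
      using coset_progression[OF aa(2) c(4)] cu hab d(3) by metis
    moreover have "u \<notin> progression (a \<otimes> a) c (2 * i)"
      using coset_progression[OF aa(1) c(4)] cu hab d(2) by metis
    ultimately show ?thesis using u unfolding sq progression_def by blast
  qed
  have aT: "a \<otimes> c [^] i \<in> T" and bT: "b \<otimes> c [^] j \<in> T"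
    unfolding T using progressionI[of i i a c] progressionI[of j j b c] by simp_all
  have ciz: "c [^] i \<lless> z"
    using gr[OF aT] mult_left_cancel_less[of a "c [^] i" z] c(1) cc zc unfolding z(2) by simp
  have less_n: "i + k < n" if "z \<otimes> c [^] k = c [^] n" for k n :: nat
  proof -
    have "c [^] i \<otimes> c [^] k \<lless> z \<otimes> c [^] k" using less_mult_right[OF ciz] cc by simp
    then show ?thesis using that pow_less_pow_iff[OF c(5)] cc by (simp add: nat_pow_mult)
  qed
  \<comment> \<open>The products \<open>x bc\<^sup>j\<close> and \<open>bc\<^sup>j x\<close> are \<open>e0\<close> and \<open>e1\<close> in one of the two orders, according to the form of
    the commutator relation.\<close>
  define e0 e1 e2 e3 where e: "e0 = h \<otimes> (z \<otimes> c [^] j)" "e1 = h \<otimes> (z \<otimes> c [^] Suc j)"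
    "e2 = a \<otimes> a \<otimes> (z \<otimes> z)" "e3 = a \<otimes> a \<otimes> (z \<otimes> c [^] i)"
  have x1: "x \<otimes> (b \<otimes> c [^] j) = a \<otimes> b \<otimes> (z \<otimes> c [^] j)"
    using mult_central_move[OF z(1), of a b] z(2) c zc cc by (simp add: m_assoc[symmetric])
  have x2: "(b \<otimes> c [^] j) \<otimes> x = b \<otimes> a \<otimes> (z \<otimes> c [^] j)"
  proof -
    have "(b \<otimes> c [^] j) \<otimes> x = b \<otimes> c [^] j \<otimes> a \<otimes> z" using z(2) c zc cc by (simp add: m_assoc)
    also have "\<dots> = b \<otimes> a \<otimes> (c [^] j \<otimes> z)"
      using mult_central_move[OF central_pow[OF c(4)], of b a] c zc cc by (simp add: m_assoc)
    finally show ?thesis using central_commutes[OF z(1), of "c [^] j"] cc by simp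
  qed
  have hs: "h \<otimes> c \<otimes> (z \<otimes> c [^] j) = e1"
  proof -
    have "c \<otimes> (z \<otimes> c [^] j) = z \<otimes> (c \<otimes> c [^] j)"
      using central_commutes[OF z(1) cc(1)] cc zc by (metis m_assoc nat_pow_closed)
    then have "c \<otimes> (z \<otimes> c [^] j) = z \<otimes> c [^] Suc j" using cc by (metis nat_pow_Suc2)
    then show ?thesis using hc cc zc e(2) by (metis m_assoc m_closed nat_pow_closed)
  qed
  have mem: "e0 \<in> insert x T <#> insert x T" "e1 \<in> insert x T <#> insert x T"
  proof -
    have "x \<otimes> (b \<otimes> c [^] j) \<in> insert x T <#> insert x T"
      "(b \<otimes> c [^] j) \<otimes> x \<in> insert x T <#> insert x T"
      using set_multI bT by simp_all
    then show "e0 \<in> insert x T <#> insert x T" "e1 \<in> insert x T <#> insert x T"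
      using x1 x2 h hs e(1) by metis+
  qed
  have xx: "x \<otimes> x = e2"
    using central_commutes[OF z(1), of "a \<otimes> z"] z(2) c zc e(3) by (simp add: m_assoc)
  have xa: "x \<otimes> (a \<otimes> c [^] i) = e3"
    using mult_central_move[OF z(1), of a a] z(2) c zc cc e(4) by (simp add: m_assoc[symmetric])
  have mem': "e2 \<in> insert x T <#> insert x T" "e3 \<in> insert x T <#> insert x T"
    unfolding xx[symmetric] xa[symmetric] using set_multI aT by simp_all
  have cos_e: "coset e0 = coset h" "coset e1 = coset h"
    "coset e2 = coset (a \<otimes> a)" "coset e3 = coset (a \<otimes> a)"
    unfolding e using coset_mult_central central_mult central_pow z(1) c(4) hc aa(1) by simp_all
  have ha: "coset h \<noteq> coset (a \<otimes> a)" using hab d(2) by simp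
  have n1: "e1 \<notin> T <#> T"
  proof
    assume "e1 \<in> T <#> T"
    then obtain n where n: "n \<le> Suc (i + j)" "e1 = h \<otimes> c [^] n" using old_h cos_e by blast
    then have "z \<otimes> c [^] Suc j = c [^] n" using e(2) hc zc cc by (metis l_cancel m_closed nat_pow_closed)
    then show False using less_n[of "Suc j" n] n(1) by linarith
  qed
  have n2: "e2 \<notin> T <#> T"
  proof
    assume "e2 \<in> T <#> T"
    then obtain n where n: "n \<le> 2 * i" "e2 = a \<otimes> a \<otimes> c [^] n" using old_aa cos_e by blast
    then have "z \<otimes> z = c [^] n" using e(3) aa(1) zc cc by (metis l_cancel m_closed nat_pow_closed)
    moreover have "c [^] i \<otimes> c [^] i \<lless> z \<otimes> z" using less_mult_both[OF ciz ciz] .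
    ultimately have "c [^] (i + i) \<lless> c [^] n" using cc by (simp add: nat_pow_mult)
    then show False using pow_less_pow_iff[OF c(5)] n(1) by simp
  qed
  have n3: "e3 \<notin> T <#> T"
  proof
    assume "e3 \<in> T <#> T"
    then obtain n where n: "n \<le> 2 * i" "e3 = a \<otimes> a \<otimes> c [^] n" using old_aa cos_e by blast
    then have "z \<otimes> c [^] i = c [^] n" using e(4) aa(1) zc cc by (metis l_cancel m_closed nat_pow_closed)
    then show False using less_n[of i n] n(1) by linarith
  qed
  have ne: "e1 \<noteq> e2" "e1 \<noteq> e3" "e0 \<noteq> e2" "e0 \<noteq> e3" using cos_e ha by metis+
  have ne23: "e2 \<noteq> e3"
  proof
    assume "e2 = e3"
    then have "z = c [^] i" using e(3,4) aa(1) zc cc by (metis l_cancel m_closed nat_pow_closed)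
    then show False using ciz by simp
  qed
  have ne01: "e0 \<noteq> e1"
  proof
    assume "e0 = e1"
    then have "c [^] j = c [^] Suc j" using e(1,2) hc zc cc by (metis l_cancel m_closed nat_pow_closed)
    then show False using pow_eq_pow_iff[OF cc, of j "Suc j"] by linarith
  qed
  have "e0 \<in> T <#> T"
  proof (rule ccontr)
    assume "e0 \<notin> T <#> T"
    then have "{e1, e2, e3, e0} \<subseteq> ?D" using n1 n2 n3 mem mem' by blast
    then have "4 \<le> card ?D" using card_ge_4I[OF finD] ne ne23 ne01 by blast
    then show False using card by linarith
  qed
  then obtain n where n: "n \<le> Suc (i + j)" "e0 = h \<otimes> c [^] n" using old_h cos_e by blast
  then have zn: "z \<otimes> c [^] j = c [^] n" using e(1) hc zc cc by (metis l_cancel m_closed nat_pow_closed)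
  then have "n = Suc i + j" using less_n n(1) by fastforce
  then have "z \<otimes> c [^] j = c [^] Suc i \<otimes> c [^] j" using zn cc by (simp only: nat_pow_mult)
  then have "z = c [^] Suc i" using zc cc by (metis nat_pow_closed r_cancel)
  then show ?thesis using z(2) by simp
qed

lemma two_progressions_adjoin:
  assumes T: "two_progressions T" "3 \<le> card T" and x: "x \<in> carrier G" "\<And>t. t \<in> T \<Longrightarrow> t \<lless> x"
    and card: "card ((insert x T <#> insert x T) - (T <#> T)) \<le> 3"
  shows "two_progressions (insert x T)"
proof -
  obtain a b c i j where c: "a \<in> carrier G" "b \<in> carrier G" "central c" "\<one> \<lless> c"
    and Tp: "T = progression a c i \<union> progression b c j"
    and rel: "a \<otimes> b = b \<otimes> a \<otimes> c \<or> b \<otimes> a = a \<otimes> b \<otimes> c"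
    using two_progressions_positive[OF T(1)] by blast
  have cc: "c \<in> carrier G" "c \<noteq> \<one>" using c by auto
  have nc: "a \<otimes> b \<noteq> b \<otimes> a" using rel c cc by (metis l_cancel_one m_closed)
  have "card T \<le> Suc i + Suc j"
    unfolding Tp using card_Un_le[of "progression a c i" "progression b c j"]
      card_progression[OF _ cc] c(1,2) by simp
  then have ij: "1 \<le> i + j" using T(2) by linarith
  have rel': "b \<otimes> a = a \<otimes> b \<otimes> c \<or> a \<otimes> b = b \<otimes> a \<otimes> c" using rel by blast
  have Tp': "T = progression b c j \<union> progression a c i" using Tp by blast
  consider "coset x = coset a" | "coset x = coset b" | "coset x \<noteq> coset a" "coset x \<noteq> coset b" by blast
  then show ?thesis
  proof cases
    case 1
    have "x = a \<otimes> c [^] Suc i"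
      using adjoin_same_coset[OF c(1,2) x(1) c(3,4) rel Tp x(2) 1 card] .
    then have "insert x T = progression a c (Suc i) \<union> progression b c j"
      unfolding Tp progression_Suc by blast
    then show ?thesis unfolding two_progressions_def using c(1,2) cc rel by blast
  next
    case 2
    have "x = b \<otimes> c [^] Suc j"
      using adjoin_same_coset[OF c(2,1) x(1) c(3,4) rel' Tp' x(2) 2 card] .
    then have "insert x T = progression a c i \<union> progression b c (Suc j)"
      unfolding Tp progression_Suc by blast
    then show ?thesis unfolding two_progressions_def using c(1,2) cc rel by blast
  next
    case 3
    have "4 \<le> card ((insert x T <#> insert x T) - (T <#> T))"
      using four_new_products[OF c(1,2) x(1) c(3) cc(2) nc 3 ij Tp] .
    then show ?thesis using card by linarith
  qed
qed

section \<open>Sets of four elements\<close>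

text \<open>Once three new products are known and no more than three exist, all others are old. This turns
  the cardinality hypothesis into equations between products.\<close>

lemma old_product:
  assumes "card (A - B) \<le> 3" "finite A" "u \<in> A" "v \<in> A" "w \<in> A" "u \<notin> B" "v \<notin> B" "w \<notin> B"
    and "u \<noteq> v" "u \<noteq> w" "v \<noteq> w" and "y \<in> A" "y \<noteq> u" "y \<noteq> v" "y \<noteq> w"
  shows "y \<in> B"
proof (rule ccontr)
  assume "y \<notin> B"
  then have "{u, v, w, y} \<subseteq> A - B" using assms by blast
  then have "4 \<le> card (A - B)" using card_ge_4I[of "A - B" u v w y] assms by blast
  then show False using assms(1) by linarith
qed

text \<open>The new products are \<open>x4 x4\<close>, \<open>x4 x3\<close> and \<open>x3 x4\<close>, so \<open>x2 x4\<close> and \<open>x4 x2\<close> are old. By size,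
  \<open>x2 x4 = x3 q\<close> and \<open>x4 x2 = r x3\<close>, where \<open>q\<close> and \<open>r\<close> are congruent modulo the centre and thus
  both \<open>x1\<close> or both \<open>x3\<close>. The first possibility contradicts the order, and in the second one
  \<open>x4\<close> commutes with the square of \<open>x3\<close>.\<close>

lemma four_elements_top_noncommuting:
  assumes less: "x1 \<lless> x2" "x2 \<lless> x3" "x3 \<lless> x4"
    and cos: "coset x1 \<noteq> coset x3" "coset x2 \<noteq> coset x3"
    and nc: "x3 \<otimes> x4 \<noteq> x4 \<otimes> x3"
    and card: "card (({x1, x2, x3, x4} <#> {x1, x2, x3, x4}) - ({x1, x2, x3} <#> {x1, x2, x3})) \<le> 3"
  shows False
proof -
  let ?S = "{x1, x2, x3, x4}" and ?T = "{x1, x2, x3}"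
  have c: "x1 \<in> carrier G" "x2 \<in> carrier G" "x3 \<in> carrier G" "x4 \<in> carrier G" using less by auto
  have l: "x1 \<lless> x3" "x1 \<lless> x4" "x2 \<lless> x4" using less less_trans by blast+
  have fin: "finite (?S <#> ?S)" using finite_set_mult by simp
  have new: "x4 \<otimes> x4 \<notin> ?T <#> ?T" "x4 \<otimes> x3 \<notin> ?T <#> ?T" "x3 \<otimes> x4 \<notin> ?T <#> ?T"
    using greatest_products_new[of x4 x3 ?T] c less l by auto
  have mem: "u \<otimes> v \<in> ?S <#> ?S" if "u \<in> ?S" "v \<in> ?S" for u v
    by (rule set_multI[OF that])
  have ne: "x4 \<otimes> x4 \<noteq> x4 \<otimes> x3" "x4 \<otimes> x4 \<noteq> x3 \<otimes> x4" "x4 \<otimes> x3 \<noteq> x3 \<otimes> x4"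
    using nc less c by auto
  have old: "y \<in> ?T <#> ?T"
    if "y \<in> ?S <#> ?S" "y \<noteq> x4 \<otimes> x4" "y \<noteq> x4 \<otimes> x3" "y \<noteq> x3 \<otimes> x4" for y
    using old_product[OF card fin _ _ _ new ne that] mem by simp
  have n: "coset (x2 \<otimes> x4) \<noteq> coset (x4 \<otimes> x3)"
    using coset_mult_left_cancel coset_mult_commute c cos by metis
  have cn: "coset (x3 \<otimes> x4) = coset (x4 \<otimes> x3)" "coset (x4 \<otimes> x2) = coset (x2 \<otimes> x4)"
    using coset_mult_commute c by simp_all
  have "x2 \<otimes> x4 \<in> ?T <#> ?T"
    by (rule old) (use mem n cn c l in auto)
  then obtain p q where pq: "p \<in> ?T" "q \<in> ?T" "x2 \<otimes> x4 = p \<otimes> q" by (rule set_multE)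
  have "x4 \<otimes> x2 \<in> ?T <#> ?T"
    by (rule old) (use mem n cn c l in \<open>auto simp del: l_cancel\<close>)
  then obtain r s where rs: "r \<in> ?T" "s \<in> ?T" "x4 \<otimes> x2 = r \<otimes> s" by (rule set_multE)
  have qs: "q \<lless> x4" "r \<lless> x4" using pq rs less l by auto
  have "p = x3"
  proof (rule ccontr)
    assume "p \<noteq> x3"
    then have "p = x2 \<or> p \<lless> x2" using pq less by auto
    then have "p \<otimes> q \<lless> x2 \<otimes> x4" using mult_le_less_mono qs c by blast
    then show False using pq by simp
  qed
  moreover have "s = x3"
  proof (rule ccontr)
    assume "s \<noteq> x3"
    then have "s = x2 \<or> s \<lless> x2" using rs less by auto
    then have "r \<otimes> s \<lless> x4 \<otimes> x2" using mult_less_le_mono qs c by blast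
    then show False using rs by simp
  qed
  ultimately have e: "x2 \<otimes> x4 = x3 \<otimes> q" "x4 \<otimes> x2 = r \<otimes> x3" using pq rs by simp_all
  have c34: "coset x4 \<noteq> coset x3" using coset_eq_commutes c nc by metis
  have q: "q = x1 \<or> q = x3"
  proof (rule ccontr)
    assume "\<not> ?thesis"
    then have "coset (x2 \<otimes> x4) = coset (x2 \<otimes> x3)" using pq(2) e(1) coset_mult_commute c by auto
    then show False using coset_mult_left_cancel c c34 by metis
  qed
  have r: "r = x1 \<or> r = x3"
  proof (rule ccontr)
    assume "\<not> ?thesis"
    then have "coset (x2 \<otimes> x4) = coset (x2 \<otimes> x3)" using rs(1) e(2) cn by auto
    then show False using coset_mult_left_cancel c c34 by metis
  qed
  have "coset (x3 \<otimes> q) = coset (r \<otimes> x3)" using e cn by simp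
  then have "coset q = coset r" using q r coset_mult_commute coset_mult_left_cancel c by metis
  then have "q = r" using q r cos by metis
  then consider "q = x1" "r = x1" | "q = x3" "r = x3" using q by blast
  then show False
  proof cases
    case 1
    have "x3 \<otimes> x1 \<lless> x4 \<otimes> x2" using less_mult_both less by blast
    then have "x3 \<otimes> x1 \<lless> x1 \<otimes> x3" using e(2) 1 by simp
    moreover have "x1 \<otimes> x3 \<lless> x2 \<otimes> x4" using less_mult_both less by blast
    ultimately show False using e(1) 1 less_asym by metis
  next
    case 2
    then have "x2 \<otimes> x4 = x4 \<otimes> x2" using e by simp
    then have "x4 \<otimes> (x3 \<otimes> x3) = x3 \<otimes> x3 \<otimes> x4" using commutes_mult[of x4 x2 x4] e(1) 2 c by simp
    then show False using commutes_square_cancel[of x4 x3] nc c by simp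
  qed
qed

text \<open>The outcome of \<open>four_elements_top_commuting\<close> in additive notation modulo the centre: there
  \<open>x4 + x2 = x1 + x3\<close> and \<open>x4 + x1\<close> is a sum of two of the elements \<open>x1\<close>, \<open>x2\<close>, \<open>x3\<close>. By linearity of
  commutation \<open>x1\<close> and \<open>x4\<close> do not commute. Each possible sum then either makes non-commuting
  elements commute, or makes \<open>x4\<close> congruent to \<open>x3\<close>.\<close>

lemma four_elements_parallelogram:
  assumes c: "x1 \<in> carrier G" "x2 \<in> carrier G" "x3 \<in> carrier G" "x4 \<in> carrier G"
    and comm: "x3 \<otimes> x4 = x4 \<otimes> x3" "x1 \<otimes> x2 = x2 \<otimes> x1" and nc: "x2 \<otimes> x4 \<noteq> x4 \<otimes> x2"
    and cos: "coset x3 \<noteq> coset x4"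
    and e: "coset (x4 \<otimes> x2) = coset (x1 \<otimes> x3)"
    and f: "p \<in> {x1, x2, x3}" "q \<in> {x1, x2, x3}" "coset (x4 \<otimes> x1) = coset (p \<otimes> q)"
  shows False
proof -
  have nc14: "x4 \<otimes> x1 \<noteq> x1 \<otimes> x4"
    using coset_commutes_four[OF c(1,3,4,2,4) e[symmetric]] comm nc by metis
  have pqc: "p \<in> carrier G" "q \<in> carrier G" using f c by auto
  have no: "coset x4 \<noteq> coset r" if "r \<in> {x1, x2, x3}" for r
    using that coset_eq_commutes[of x4] nc14 nc cos c by (metis empty_iff insert_iff)
  have p1: "p \<noteq> x1"
  proof
    assume "p = x1"
    then have "coset (x1 \<otimes> x4) = coset (x1 \<otimes> q)" using f coset_mult_commute c by metis
    then show False using coset_mult_left_cancel no f(2) c pqc by metis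
  qed
  have q1: "q \<noteq> x1"
  proof
    assume "q = x1"
    then have "coset (x4 \<otimes> x1) = coset (p \<otimes> x1)" using f by metis
    then show False using coset_mult_right_cancel no f(1) c pqc by metis
  qed
  \<comment> \<open>Adding the two relations gives \<open>2 x4 + (x1 + x2) = 2 x3 + (x1 + x2)\<close>.\<close>
  have mixed: False if m: "coset (x4 \<otimes> x1) = coset (x2 \<otimes> x3)"
  proof -
    have "coset (x4 \<otimes> x1 \<otimes> (x4 \<otimes> x2)) = coset (x2 \<otimes> x3 \<otimes> (x1 \<otimes> x3))"
      using coset_mult_cong[of "x4 \<otimes> x1" "x2 \<otimes> x3" "x4 \<otimes> x2" "x1 \<otimes> x3"] m e c by simp
    then have "coset (x4 \<otimes> x4 \<otimes> (x1 \<otimes> x2)) = coset (x2 \<otimes> x1 \<otimes> (x3 \<otimes> x3))"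
      using coset_mult_interchange[of x4 x1 x4 x2] coset_mult_interchange[of x2 x3 x1 x3] c by simp
    also have "\<dots> = coset (x3 \<otimes> x3 \<otimes> (x1 \<otimes> x2))"
      using coset_mult_commute[of "x2 \<otimes> x1" "x3 \<otimes> x3"] comm(2) c by simp
    finally have "coset (x4 \<otimes> x4) = coset (x3 \<otimes> x3)"
      using coset_mult_right_cancel[of "x1 \<otimes> x2"] c by simp
    then show False using coset_square_cancel cos c by metis
  qed
  consider "p = x2" "q = x2" | "p = x3" "q = x3" | "p = x2" "q = x3" | "p = x3" "q = x2"
    using f p1 q1 by blast
  then show False
  proof cases
    case 1
    then have "coset (x2 \<otimes> x2) = coset (x1 \<otimes> x4)" using f coset_mult_commute c by metis
    from coset_commutes_four[OF c(2,2,1,4,2) this] show False using comm nc by metis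
  next
    case 2
    then have "coset (x3 \<otimes> x3) = coset (x4 \<otimes> x1)" using f by metis
    from coset_commutes_four[OF c(3,3,4,1,4) this] show False using comm nc14 by metis
  next
    case 3
    then show False using mixed f by metis
  next
    case 4
    then show False using mixed f coset_mult_commute c by metis
  qed
qed

text \<open>The third new product, after \<open>x4 x4\<close> and \<open>x4 x3\<close>, is the larger of \<open>x2 x4\<close> and \<open>x4 x2\<close>. The
  smaller one is old, and by size and commutation it must be congruent to \<open>x1 x3\<close>.\<close>

lemma four_elements_top_commuting:
  assumes less: "x1 \<lless> x2" "x2 \<lless> x3" "x3 \<lless> x4"
    and cos: "coset x2 \<noteq> coset x3" "coset x3 \<noteq> coset x4"
    and comm: "x3 \<otimes> x4 = x4 \<otimes> x3" "x1 \<otimes> x2 = x2 \<otimes> x1" and nc: "x2 \<otimes> x4 \<noteq> x4 \<otimes> x2"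
    and card: "card (({x1, x2, x3, x4} <#> {x1, x2, x3, x4}) - ({x1, x2, x3} <#> {x1, x2, x3})) \<le> 3"
  shows False
proof -
  let ?S = "{x1, x2, x3, x4}" and ?T = "{x1, x2, x3}"
  have c: "x1 \<in> carrier G" "x2 \<in> carrier G" "x3 \<in> carrier G" "x4 \<in> carrier G" using less by auto
  have l: "x1 \<lless> x3" "x1 \<lless> x4" "x2 \<lless> x4" using less less_trans by blast+
  have lT: "s \<lless> x4" if "s \<in> ?T" for s using that less l by auto
  have Tc: "?T \<subseteq> carrier G" using c by simp
  have fin: "finite (?S <#> ?S)" using finite_set_mult by simp
  have new: "x4 \<otimes> x4 \<notin> ?T <#> ?T" "x4 \<otimes> x3 \<notin> ?T <#> ?T"
    using greatest_products_new[of x4 x3 ?T] c less l by auto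
  have mem: "u \<otimes> v \<in> ?S <#> ?S" if "u \<in> ?S" "v \<in> ?S" for u v
    by (rule set_multI[OF that])
  have above: "x4 \<otimes> s = s \<otimes> x4" if "s \<in> ?T" "x2 \<lless> s" for s
    using that less less_asym comm by auto
  have ne: "x4 \<otimes> x4 \<noteq> x4 \<otimes> x3" using less c by auto
  have d: "x1 \<noteq> x2" "x1 \<noteq> x3" "x1 \<noteq> x4" "x2 \<noteq> x3" "x2 \<noteq> x4" using less l by auto
  have x3: "x1 \<otimes> x4 \<noteq> x3 \<otimes> x4" "x2 \<otimes> x4 \<noteq> x3 \<otimes> x4" using d c by simp_all
  have x14: "x1 \<otimes> x4 \<noteq> x4 \<otimes> x4" "x1 \<otimes> x4 \<noteq> x4 \<otimes> x3" "x1 \<otimes> x4 \<noteq> x2 \<otimes> x4"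
    "x4 \<otimes> x1 \<noteq> x4 \<otimes> x4" "x4 \<otimes> x1 \<noteq> x4 \<otimes> x3" "x4 \<otimes> x1 \<noteq> x4 \<otimes> x2"
    using x3(1) unfolding comm(1) using d c by simp_all
  have x24: "x2 \<otimes> x4 \<noteq> x4 \<otimes> x4" "x2 \<otimes> x4 \<noteq> x4 \<otimes> x3"
    "x4 \<otimes> x2 \<noteq> x4 \<otimes> x4" "x4 \<otimes> x2 \<noteq> x4 \<otimes> x3"
    using x3(2) unfolding comm(1) using d c by simp_all
  have par: False if e: "coset (x4 \<otimes> x2) = coset (x1 \<otimes> x3)"
    and f: "x1 \<otimes> x4 \<in> ?T <#> ?T \<or> x4 \<otimes> x1 \<in> ?T <#> ?T"
  proof -
    obtain p q where pq: "p \<in> ?T" "q \<in> ?T" "x1 \<otimes> x4 = p \<otimes> q \<or> x4 \<otimes> x1 = p \<otimes> q"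
      using f by (metis set_multE)
    then have "coset (x4 \<otimes> x1) = coset (p \<otimes> q)" using coset_mult_commute c by metis
    then show False using four_elements_parallelogram[OF c comm nc cos(2) e pq(1,2)] by blast
  qed
  have "x2 \<otimes> x4 \<lless> x4 \<otimes> x2 \<or> x4 \<otimes> x2 \<lless> x2 \<otimes> x4" using less_linear nc c by blast
  then show False
  proof
    assume lw: "x4 \<otimes> x2 \<lless> x2 \<otimes> x4"
    have w: "x2 \<otimes> x4 \<notin> ?T <#> ?T"
      using larger_noncommuting_product_new(1)[OF Tc c(4) lT _ above lw] by simp
    have old: "y \<in> ?T <#> ?T"
      if "y \<in> ?S <#> ?S" "y \<noteq> x4 \<otimes> x4" "y \<noteq> x4 \<otimes> x3" "y \<noteq> x2 \<otimes> x4" for y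
      using old_product[OF card fin _ _ _ new w ne _ _ that] mem x24 by auto
    have "x4 \<otimes> x2 \<in> ?T <#> ?T" by (rule old) (use mem x24 nc in auto)
    then obtain r s where rs: "r \<in> ?T" "s \<in> ?T" "x4 \<otimes> x2 = r \<otimes> s" by (rule set_multE)
    have s: "s = x3"
    proof (rule ccontr)
      assume "s \<noteq> x3"
      then have "s = x2 \<or> s \<lless> x2" using rs less by auto
      then have "r \<otimes> s \<lless> x4 \<otimes> x2" using mult_less_le_mono lT rs c by blast
      then show False using rs by simp
    qed
    have "r \<noteq> x3"
    proof
      assume "r = x3"
      then have e: "x4 \<otimes> x2 = x3 \<otimes> x3" using rs(3) s by simp
      have "x4 \<otimes> (x4 \<otimes> x2) = x4 \<otimes> x2 \<otimes> x4"
        unfolding e using commutes_mult[OF c(4,3,3)] comm(1) by metis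
      then show False using commutes_mult_left_cancel[of x4 x4 x2] nc c by simp
    qed
    moreover have "r \<noteq> x2"
    proof
      assume "r = x2"
      then have "coset (x2 \<otimes> x4) = coset (x2 \<otimes> x3)" using rs(3) s coset_mult_commute c by metis
      then show False using coset_mult_left_cancel cos(2) c by metis
    qed
    ultimately have "r = x1" using rs(1) by blast
    then have "coset (x4 \<otimes> x2) = coset (x1 \<otimes> x3)" using rs(3) s by simp
    moreover have "x1 \<otimes> x4 \<in> ?T <#> ?T" by (rule old) (use mem x14 in auto)
    ultimately show False using par by blast
  next
    assume lw: "x2 \<otimes> x4 \<lless> x4 \<otimes> x2"
    have w: "x4 \<otimes> x2 \<notin> ?T <#> ?T"
      using larger_noncommuting_product_new(2)[OF Tc c(4) lT _ above lw] by simp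
    have old: "y \<in> ?T <#> ?T"
      if "y \<in> ?S <#> ?S" "y \<noteq> x4 \<otimes> x4" "y \<noteq> x4 \<otimes> x3" "y \<noteq> x4 \<otimes> x2" for y
      using old_product[OF card fin _ _ _ new w ne _ _ that] mem x24 by auto
    have "x2 \<otimes> x4 \<in> ?T <#> ?T" by (rule old) (use mem x24 nc in auto)
    then obtain r s where rs: "r \<in> ?T" "s \<in> ?T" "x2 \<otimes> x4 = r \<otimes> s" by (rule set_multE)
    have r: "r = x3"
    proof (rule ccontr)
      assume "r \<noteq> x3"
      then have "r = x2 \<or> r \<lless> x2" using rs less by auto
      then have "r \<otimes> s \<lless> x2 \<otimes> x4" using mult_le_less_mono lT rs c by blast
      then show False using rs by simp
    qed
    have "s \<noteq> x3"
    proof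
      assume "s = x3"
      then have e: "x2 \<otimes> x4 = x3 \<otimes> x3" using rs(3) r by simp
      have "x4 \<otimes> (x2 \<otimes> x4) = x2 \<otimes> x4 \<otimes> x4"
        unfolding e using commutes_mult[OF c(4,3,3)] comm(1) by metis
      then show False using commutes_mult_right_cancel[of x4 x2 x4] nc c by simp
    qed
    moreover have "s \<noteq> x2"
    proof
      assume "s = x2"
      then have "coset (x4 \<otimes> x2) = coset (x3 \<otimes> x2)" using rs(3) r coset_mult_commute c by metis
      then show False using coset_mult_right_cancel cos(2) c by metis
    qed
    ultimately have "s = x1" using rs(2) by blast
    then have "coset (x4 \<otimes> x2) = coset (x1 \<otimes> x3)" using rs(3) r coset_mult_commute c by metis
    moreover have "x4 \<otimes> x1 \<in> ?T <#> ?T" by (rule old) (use mem x14 in auto)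
    ultimately show False using par by blast
  qed
qed

text \<open>The third new product, after \<open>x4 x4\<close> and \<open>x4 x3\<close>, is the larger of \<open>x1 x4\<close> and \<open>x4 x1\<close>, so
  \<open>x2 x4\<close> is old. Every equation \<open>x2 x4 = pq\<close> with factors among \<open>x1\<close>, \<open>x2\<close>, \<open>x3\<close> makes one of
  the two non-commuting pairs commute.\<close>

lemma four_elements_two_pairs:
  assumes less: "x1 \<lless> x2" "x2 \<lless> x3" "x3 \<lless> x4"
    and comm: "x1 \<otimes> x2 = x2 \<otimes> x1" "x1 \<otimes> x3 = x3 \<otimes> x1" "x2 \<otimes> x4 = x4 \<otimes> x2" "x3 \<otimes> x4 = x4 \<otimes> x3"
    and nc: "x1 \<otimes> x4 \<noteq> x4 \<otimes> x1" "x2 \<otimes> x3 \<noteq> x3 \<otimes> x2"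
    and card: "card (({x1, x2, x3, x4} <#> {x1, x2, x3, x4}) - ({x1, x2, x3} <#> {x1, x2, x3})) \<le> 3"
  shows False
proof -
  let ?S = "{x1, x2, x3, x4}" and ?T = "{x1, x2, x3}"
  have c: "x1 \<in> carrier G" "x2 \<in> carrier G" "x3 \<in> carrier G" "x4 \<in> carrier G" using less by auto
  have l: "x1 \<lless> x3" "x1 \<lless> x4" "x2 \<lless> x4" using less less_trans by blast+
  have lT: "s \<lless> x4" if "s \<in> ?T" for s using that less l by auto
  have Tc: "?T \<subseteq> carrier G" using c by simp
  have fin: "finite (?S <#> ?S)" using finite_set_mult by simp
  have new: "x4 \<otimes> x4 \<notin> ?T <#> ?T" "x4 \<otimes> x3 \<notin> ?T <#> ?T"
    using greatest_products_new[of x4 x3 ?T] c less l by auto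
  have mem: "u \<otimes> v \<in> ?S <#> ?S" if "u \<in> ?S" "v \<in> ?S" for u v
    by (rule set_multI[OF that])
  have above: "x4 \<otimes> s = s \<otimes> x4" if "s \<in> ?T" "x1 \<lless> s" for s
    using that comm by auto
  define w where "w = (if x4 \<otimes> x1 \<lless> x1 \<otimes> x4 then x1 \<otimes> x4 else x4 \<otimes> x1)"
  have w: "w \<notin> ?T <#> ?T"
    using larger_noncommuting_product_new[OF Tc c(4) lT _ above]
      less_linear[of "x4 \<otimes> x1" "x1 \<otimes> x4"] nc(1) c unfolding w_def by auto
  have wS: "w \<in> ?S <#> ?S" using mem unfolding w_def by simp
  have d: "x1 \<noteq> x2" "x1 \<noteq> x3" "x1 \<noteq> x4" "x2 \<noteq> x3" "x2 \<noteq> x4" "x3 \<noteq> x4" using less l by auto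
  have x3: "x1 \<otimes> x4 \<noteq> x3 \<otimes> x4" "x2 \<otimes> x4 \<noteq> x3 \<otimes> x4" using d c by simp_all
  have ne: "x4 \<otimes> x4 \<noteq> x4 \<otimes> x3" "x4 \<otimes> x4 \<noteq> w" "x4 \<otimes> x3 \<noteq> w"
    using d x3(1) c unfolding w_def comm(4) by auto
  have old: "y \<in> ?T <#> ?T"
    if "y \<in> ?S <#> ?S" "y \<noteq> x4 \<otimes> x4" "y \<noteq> x4 \<otimes> x3" "y \<noteq> w" for y
    using old_product[OF card fin _ _ wS new w ne that] mem by simp
  have "x2 \<otimes> x4 \<in> ?T <#> ?T"
  proof (rule old)
    have "x4 \<otimes> x2 \<noteq> x4 \<otimes> x1" "x2 \<otimes> x4 \<noteq> x1 \<otimes> x4" using d c by simp_all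
    then show "x2 \<otimes> x4 \<noteq> w" using comm(3) unfolding w_def by simp
    show "x2 \<otimes> x4 \<noteq> x4 \<otimes> x3" using x3(2) comm(4) by simp
  qed (use mem d c in auto)
  then obtain p q where pq: "p \<in> ?T" "q \<in> ?T" "x2 \<otimes> x4 = p \<otimes> q" by (rule set_multE)
  have pqc: "p \<in> carrier G" "q \<in> carrier G" using pq c by auto
  have no: "coset x4 \<noteq> coset r" if r: "r \<in> ?T" for r
  proof
    assume e: "coset x4 = coset r"
    consider "r = x1" | "r = x2" | "r = x3" using r by blast
    then show False
    proof cases
      case 1
      then show False using coset_eq_commutes e nc(1) c by metis
    next
      case 2
      then show False using coset_commutes[of x3 x4 x2] e nc(2) comm(4) c by metis
    next
      case 3
      then show False using coset_commutes[of x2 x4 x3] e nc(2) comm(3) c by metis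
    qed
  qed
  have p2: "p \<noteq> x2"
  proof
    assume "p = x2"
    then show False using pq no[OF pq(2)] pqc c by simp
  qed
  have q2: "q \<noteq> x2"
  proof
    assume "q = x2"
    then have "coset (x4 \<otimes> x2) = coset (p \<otimes> x2)" using pq comm(3) by metis
    then show False using coset_mult_right_cancel no pq(1) c pqc by metis
  qed
  consider "p = x1" "q = x1" | "p = x3" "q = x3" | "p = x3" "q = x1" | "p = x1" "q = x3"
    using pq(1,2) p2 q2 by blast
  then show False
  proof cases
    case 1
    then have "coset (x1 \<otimes> x1) = coset (x2 \<otimes> x4)" using pq(3) by simp
    from coset_commutes_four[OF c(1,1,2,4,1) this] show False using comm nc by metis
  next
    case 2
    have "x2 \<otimes> (x2 \<otimes> x4) = x2 \<otimes> x4 \<otimes> x2" using commutes_mult[of x2 x2 x4] comm(3) c by simp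
    then have "x2 \<otimes> (x3 \<otimes> x3) = x3 \<otimes> x3 \<otimes> x2" using pq(3) 2 by simp
    then show False using commutes_square_cancel[of x2 x3] nc c by simp
  next
    case 3
    then have "coset (x2 \<otimes> x4) = coset (x3 \<otimes> x1)" using pq(3) by simp
    from coset_commutes_four[OF c(2,4,3,1,4) this] show False using comm nc by metis
  next
    case 4
    then have "coset (x2 \<otimes> x4) = coset (x3 \<otimes> x1)" using pq(3) comm(2) by simp
    from coset_commutes_four[OF c(2,4,3,1,4) this] show False using comm nc by metis
  qed
qed

section \<open>The inverse theorem\<close>

text \<open>The lower bounds \<open>3\<close> for the new products and \<open>3 card T - 2\<close> for the old ones, with
  \<open>T = S - {x}\<close>, add up to \<open>3 card S - 2\<close>. Hence neither can be exceeded.\<close>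

lemma remove_greatest:
  assumes S: "finite S" "S \<subseteq> carrier G" and x: "x \<in> S" "\<And>s. s \<in> S - {x} \<Longrightarrow> s \<lless> x"
    and nc: "p \<in> S - {x}" "q \<in> S - {x}" "p \<otimes> q \<noteq> q \<otimes> p"
    and card: "card (S <#> S) + 2 \<le> 3 * card S"
  shows "card ((S <#> S) - ((S - {x}) <#> (S - {x}))) \<le> 3"
    and "card ((S - {x}) <#> (S - {x})) + 2 \<le> 3 * card (S - {x})"
proof -
  let ?T = "S - {x}"
  have T: "finite ?T" "?T \<subseteq> carrier G" using S by auto
  have sub: "?T <#> ?T \<subseteq> S <#> S" using mono_set_mult[of ?T S ?T S] by blast
  have fin: "finite (S <#> S)" "finite (?T <#> ?T)" using finite_set_mult S T by blast+
  have "card ((S <#> S) - (?T <#> ?T)) + card (?T <#> ?T) = card (S <#> S)"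
    using card_Diff_subset[OF fin(2) sub] card_mono[OF fin(1) sub] by linarith
  moreover have "3 \<le> card ((S <#> S) - (?T <#> ?T))" using three_new_products[OF S x nc] .
  moreover have "3 * card ?T \<le> card (?T <#> ?T) + 2" using card_square_ge_noncommuting[OF T nc] .
  moreover have "card S = Suc (card ?T)" using S x card_Suc_Diff1 by metis
  ultimately show "card ((S <#> S) - (?T <#> ?T)) \<le> 3"
    "card (?T <#> ?T) + 2 \<le> 3 * card ?T"
    using card by linarith+
qed

text \<open>Equality for \<open>S\<close> means at most seven products for the triple \<open>S - {x}\<close>, which its congruent
  pair turns into two progressions; these are then extended by \<open>x\<close>.\<close>

lemma four_elements_congruent_pair:
  assumes S: "finite S" "S \<subseteq> carrier G" "card S = 4"
    and x: "x \<in> S" "\<And>s. s \<in> S - {x} \<Longrightarrow> s \<lless> x"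
    and nc: "\<exists>p\<in>S - {x}. \<exists>q\<in>S - {x}. p \<otimes> q \<noteq> q \<otimes> p"
    and card: "card (S <#> S) \<le> 10"
    and uv: "u \<in> S - {x}" "v \<in> S - {x}" "u \<noteq> v" "coset u = coset v"
  shows "two_progressions S"
proof -
  let ?T = "S - {x}"
  have xc: "x \<in> carrier G" using x S by auto
  have Sx: "insert x ?T = S" using x by blast
  have cT: "card ?T = 3" using S x by simp
  obtain p q where pq: "p \<in> ?T" "q \<in> ?T" "p \<otimes> q \<noteq> q \<otimes> p" using nc by blast
  have ct: "card (S <#> S) + 2 \<le> 3 * card S" using card S(3) by simp
  have c3: "card ((S <#> S) - (?T <#> ?T)) \<le> 3" and c7: "card (?T <#> ?T) + 2 \<le> 3 * card ?T"
    using remove_greatest[OF S(1,2) x pq ct] by blast+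
  have "card (?T - {u, v}) = 1" using uv cT S(1) by (simp add: card_Diff_subset)
  then obtain y where y: "?T - {u, v} = {y}" using card_1_singletonE by blast
  have T: "?T = {y, u, v}" using y uv by blast
  have c: "y \<in> carrier G" "u \<in> carrier G" "v \<in> carrier G" using T S(2) by blast+
  have uv': "u \<otimes> v = v \<otimes> u" using coset_eq_commutes uv(4) c by blast
  have "y \<otimes> u \<noteq> u \<otimes> y"
  proof
    assume yu: "y \<otimes> u = u \<otimes> y"
    then have "y \<otimes> v = v \<otimes> y" using coset_commutes[OF c(1,2,3) uv(4)] by simp
    then show False using pq uv' yu unfolding T by auto
  qed
  then have "two_progressions ?T"
    unfolding T using two_progressions_if_congruent_pair[OF c(2,3,1) uv(3,4)] c7 cT unfolding T by simp
  then have "two_progressions (insert x ?T)"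
    by (rule two_progressions_adjoin) (use cT xc x(2) c3 Sx in simp_all)
  then show ?thesis unfolding Sx .
qed

text \<open>The lemmas \<open>four_elements_top_noncommuting\<close> and \<open>four_elements_top_commuting\<close>, each with its
  mirror image under the converse order, show in turn that \<open>x3, x4\<close>, then \<open>x1, x2\<close>, then \<open>x2, x4\<close>
  and \<open>x1, x3\<close> commute. The only non-commuting pairs left are \<open>x1, x4\<close> and \<open>x2, x3\<close>, which is
  the case of \<open>four_elements_two_pairs\<close>.\<close>

lemma four_elements_separated:
  assumes less: "x1 \<lless> x2" "x2 \<lless> x3" "x3 \<lless> x4"
    and cos: "coset x1 \<noteq> coset x2" "coset x1 \<noteq> coset x3" "coset x2 \<noteq> coset x3"
      "coset x2 \<noteq> coset x4" "coset x3 \<noteq> coset x4"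
    and comm13: "\<not> (x1 \<otimes> x2 = x2 \<otimes> x1 \<and> x1 \<otimes> x3 = x3 \<otimes> x1 \<and> x2 \<otimes> x3 = x3 \<otimes> x2)"
    and comm24: "\<not> (x1 \<otimes> x2 = x2 \<otimes> x1 \<and> x1 \<otimes> x4 = x4 \<otimes> x1 \<and> x2 \<otimes> x4 = x4 \<otimes> x2)"
    and card: "card (({x1, x2, x3, x4} <#> {x1, x2, x3, x4}) - ({x1, x2, x3} <#> {x1, x2, x3})) \<le> 3"
    and card': "card (({x1, x2, x3, x4} <#> {x1, x2, x3, x4}) - ({x2, x3, x4} <#> {x2, x3, x4})) \<le> 3"
  shows False
proof -
  interpret converse: ordered_class2_group G "R\<inverse>" by (rule ordered_class2_group_converse)
  have set: "{x4, x3, x2, x1} = {x1, x2, x3, x4}" "{x4, x3, x2} = {x2, x3, x4}" by auto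
  have less': "(x4, x3) \<in> R\<inverse>" "(x3, x2) \<in> R\<inverse>" "(x2, x1) \<in> R\<inverse>" using less by simp_all
  have cardc: "card (({x4, x3, x2, x1} <#> {x4, x3, x2, x1}) - ({x4, x3, x2} <#> {x4, x3, x2})) \<le> 3"
    unfolding set using card' .
  have c34: "x3 \<otimes> x4 = x4 \<otimes> x3"
    using four_elements_top_noncommuting[OF less cos(2,3) _ card] by blast
  have c12: "x2 \<otimes> x1 = x1 \<otimes> x2"
    using converse.four_elements_top_noncommuting[OF less' cos(4)[symmetric] cos(3)[symmetric] _ cardc]
    by blast
  have c24: "x2 \<otimes> x4 = x4 \<otimes> x2"
    using four_elements_top_commuting[OF less cos(3,5) c34 c12[symmetric] _ card] by blast
  have c13: "x3 \<otimes> x1 = x1 \<otimes> x3"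
    using converse.four_elements_top_commuting[OF less' cos(3)[symmetric] cos(1)[symmetric] c12
        c34[symmetric] _ cardc] by blast
  have "x2 \<otimes> x3 \<noteq> x3 \<otimes> x2" "x1 \<otimes> x4 \<noteq> x4 \<otimes> x1" using comm13 comm24 c12 c13 c24 by auto
  then show False
    using four_elements_two_pairs[OF less c12[symmetric] c13[symmetric] c24 c34 _ _ card] by blast
qed

lemma two_progressions_four_elements:
  assumes S: "finite S" "S \<subseteq> carrier G" "card S = 4" and card: "card (S <#> S) \<le> 10"
    and nc: "\<And>y. y \<in> S \<Longrightarrow> \<exists>p\<in>S - {y}. \<exists>q\<in>S - {y}. p \<otimes> q \<noteq> q \<otimes> p"
  shows "two_progressions S"
proof (rule ccontr)
  assume no: "\<not> two_progressions S"
  interpret converse: ordered_class2_group G "R\<inverse>" by (rule ordered_class2_group_converse)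
  have "S \<noteq> {}" using S(3) by auto
  then obtain x4 where x4: "x4 \<in> S" "\<And>s. s \<in> S - {x4} \<Longrightarrow> s \<lless> x4"
    using obtain_greatest[OF S(1) _ S(2)] by metis
  obtain x1 where x1: "x1 \<in> S" "\<And>s. s \<in> S - {x1} \<Longrightarrow> (s, x1) \<in> R\<inverse>"
    using converse.obtain_greatest[OF S(1) \<open>S \<noteq> {}\<close> S(2)] by metis
  have x14: "x1 \<noteq> x4"
  proof
    assume e: "x1 = x4"
    have "S - {x4} = {}"
    proof (rule ccontr)
      assume "S - {x4} \<noteq> {}"
      then obtain s where "s \<in> S - {x4}" by blast
      then show False using x4(2)[of s] x1(2)[of s] e less_asym by auto
    qed
    then show False using S(1,3) x4(1) by (metis card.empty card_Suc_Diff1 numeral_eq_one_iff One_nat_def semiring_norm(83))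
  qed
  have "card (S - {x1, x4}) = 2" using S x1(1) x4(1) x14 by (simp add: card_Diff_subset)
  then obtain u v where uv: "S - {x1, x4} = {u, v}" "u \<noteq> v" by (meson card_2_iff)
  have uvc: "u \<in> carrier G" "v \<in> carrier G" using uv S(2) by blast+
  obtain x2 x3 where x23: "S - {x1, x4} = {x2, x3}" "x2 \<lless> x3"
    using less_linear[OF uvc uv(2)] uv(1) by (metis insert_commute)
  have less: "x1 \<lless> x2" "x2 \<lless> x3" "x3 \<lless> x4" using x1(2) x4(2) x23 by blast+
  have l: "x1 \<lless> x3" "x2 \<lless> x4" "x1 \<lless> x4" using less less_trans by blast+
  have d: "x1 \<noteq> x2" "x1 \<noteq> x3" "x1 \<noteq> x4" "x2 \<noteq> x3" "x2 \<noteq> x4" "x3 \<noteq> x4"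
    using less l by auto
  have Seq: "S = {x1, x2, x3, x4}" using x23(1) x1(1) x4(1) by blast
  have T4: "S - {x4} = {x1, x2, x3}" unfolding Seq using d by auto
  have T1: "S - {x1} = {x2, x3, x4}" unfolding Seq using d by auto
  have T3: "S - {x3} = {x1, x2, x4}" unfolding Seq using d by auto
  have cS: "card (S <#> S) + 2 \<le> 3 * card S" using card S(3) by simp
  have sep: "coset s \<noteq> coset t" if "s \<in> S - {x4}" "t \<in> S - {x4}" "s \<noteq> t" for s t
    using four_elements_congruent_pair[OF S x4 nc[OF x4(1)] card that] no by blast
  have sep': "coset s \<noteq> coset t" if "s \<in> S - {x1}" "t \<in> S - {x1}" "s \<noteq> t" for s t
    using converse.four_elements_congruent_pair[OF S x1 nc[OF x1(1)] card that] no by blast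
  obtain p q where pq: "p \<in> S - {x4}" "q \<in> S - {x4}" "p \<otimes> q \<noteq> q \<otimes> p" using nc[OF x4(1)] by blast
  obtain p' q' where pq': "p' \<in> S - {x1}" "q' \<in> S - {x1}" "p' \<otimes> q' \<noteq> q' \<otimes> p'"
    using nc[OF x1(1)] by blast
  show False
  proof (rule four_elements_separated[OF less])
    show "coset x1 \<noteq> coset x2" "coset x1 \<noteq> coset x3" "coset x2 \<noteq> coset x3"
      using sep d unfolding T4 by simp_all
    show "coset x2 \<noteq> coset x4" "coset x3 \<noteq> coset x4"
      using sep' d unfolding T1 by simp_all
    show "\<not> (x1 \<otimes> x2 = x2 \<otimes> x1 \<and> x1 \<otimes> x3 = x3 \<otimes> x1 \<and> x2 \<otimes> x3 = x3 \<otimes> x2)"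
      using pq unfolding T4 by auto
    show "\<not> (x1 \<otimes> x2 = x2 \<otimes> x1 \<and> x1 \<otimes> x4 = x4 \<otimes> x1 \<and> x2 \<otimes> x4 = x4 \<otimes> x2)"
      using nc[of x3] unfolding T3 Seq by auto
    show "card (({x1, x2, x3, x4} <#> {x1, x2, x3, x4}) - ({x1, x2, x3} <#> {x1, x2, x3})) \<le> 3"
      using remove_greatest(1)[OF S(1,2) x4 pq cS] unfolding T4 unfolding Seq .
    show "card (({x1, x2, x3, x4} <#> {x1, x2, x3, x4}) - ({x2, x3, x4} <#> {x2, x3, x4})) \<le> 3"
      using converse.remove_greatest(1)[OF S(1,2) x1 pq' cS] unfolding T1 unfolding Seq .
  qed
qed

text \<open>Sets that commute after the removal of one element are settled directly. For all others the
  removal of the greatest element leads down to four elements.\<close>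

lemma two_progressions_if_card_square:
  assumes "finite S" "S \<subseteq> carrier G" "4 \<le> card S" "card (S <#> S) + 2 \<le> 3 * card S"
    and "p \<in> S" "q \<in> S" "p \<otimes> q \<noteq> q \<otimes> p"
  shows "two_progressions S"
  using assms
proof (induction "card S" arbitrary: S p q rule: less_induct)
  case less
  note S = less.prems(1,2) and card = less.prems(4) and pq = less.prems(5-7)
  show ?case
  proof (cases "\<exists>y\<in>S. \<forall>s\<in>S - {y}. \<forall>t\<in>S - {y}. s \<otimes> t = t \<otimes> s")
    case True
    then obtain y where y: "y \<in> S" and comm: "\<And>s t. \<lbrakk>s \<in> S - {y}; t \<in> S - {y}\<rbrakk> \<Longrightarrow> s \<otimes> t = t \<otimes> s"
      by blast
    let ?T = "S - {y}"
    have Sy: "insert y ?T = S" using y by blast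
    have T: "finite ?T" "?T \<subseteq> carrier G" and yc: "y \<in> carrier G" using S y by auto
    have cT: "card S = Suc (card ?T)" using S y card_Suc_Diff1 by metis
    obtain t where t: "t \<in> ?T" "y \<otimes> t \<noteq> t \<otimes> y" using pq comm by (metis Diff_iff singletonD)
    have "two_progressions (insert y ?T)"
    proof (rule two_progressions_if_commuting_part[OF T yc comm t])
      show "3 \<le> card ?T" using less.prems(3) cT by linarith
      show "card (insert y ?T <#> insert y ?T) \<le> 3 * card ?T + 1" unfolding Sy using card cT by linarith
    qed
    then show ?thesis unfolding Sy .
  next
    case False
    then have nc: "\<exists>p\<in>S - {y}. \<exists>q\<in>S - {y}. p \<otimes> q \<noteq> q \<otimes> p" if "y \<in> S" for y using that by blast
    show ?thesis
    proof (cases "card S = 4")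
      case True
      then have "card (S <#> S) \<le> 10" using card by linarith
      then show ?thesis using two_progressions_four_elements[OF S True] nc by blast
    next
      case False
      have "S \<noteq> {}" using pq by blast
      then obtain x where x: "x \<in> S" "\<And>s. s \<in> S - {x} \<Longrightarrow> s \<lless> x"
        using obtain_greatest[OF S(1) _ S(2)] by metis
      let ?T = "S - {x}"
      have Sx: "insert x ?T = S" using x by blast
      have T: "finite ?T" "?T \<subseteq> carrier G" and xc: "x \<in> carrier G" using S x by auto
      have cT: "card S = Suc (card ?T)" using S x card_Suc_Diff1 by metis
      obtain p' q' where pq': "p' \<in> ?T" "q' \<in> ?T" "p' \<otimes> q' \<noteq> q' \<otimes> p'" using nc[OF x(1)] by blast
      note r = remove_greatest[OF S x pq' card]
      have T4: "4 \<le> card ?T" using less.prems(3) False cT by linarith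
      have "card ?T < card S" using cT by linarith
      then have "two_progressions ?T"
        using less.hyps[of ?T p' q'] T T4 r(2) pq' by blast
      then have "two_progressions (insert x ?T)"
        by (rule two_progressions_adjoin) (use T4 xc x(2) r(1) Sx in simp_all)
      then show ?thesis unfolding Sx .
    qed
  qed
qed

end

text \<open>If the generators commute pairwise, the subgroup generated by them centralises the
  generators, and a second application shows that it centralises itself.\<close>

lemma (in group) noncommuting_generators:
  assumes "S \<subseteq> carrier G" "\<not> comm_group (G\<lparr>carrier := generate G S\<rparr>)"
  shows "\<exists>p\<in>S. \<exists>q\<in>S. p \<otimes> q \<noteq> q \<otimes> p"
proof (rule ccontr)
  assume "\<not> ?thesis"
  then have comm: "\<And>p q. \<lbrakk>p \<in> S; q \<in> S\<rbrakk> \<Longrightarrow> p \<otimes> q = q \<otimes> p" by blast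
  have cent: "subgroup {g \<in> carrier G. \<forall>s\<in>A. g \<otimes> s = s \<otimes> g} G" if A: "A \<subseteq> carrier G" for A
  proof
    fix g h assume g: "g \<in> {g \<in> carrier G. \<forall>s\<in>A. g \<otimes> s = s \<otimes> g}"
      and h: "h \<in> {g \<in> carrier G. \<forall>s\<in>A. g \<otimes> s = s \<otimes> g}"
    have "g \<otimes> h \<otimes> s = s \<otimes> (g \<otimes> h)" if "s \<in> A" for s
    proof -
      have "g \<in> carrier G" "h \<in> carrier G" "s \<in> carrier G" "g \<otimes> s = s \<otimes> g" "h \<otimes> s = s \<otimes> h"
        using g h that A by auto
      then show ?thesis by (metis m_assoc)
    qed
    then show "g \<otimes> h \<in> {g \<in> carrier G. \<forall>s\<in>A. g \<otimes> s = s \<otimes> g}" using g h by simp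
  next
    fix g assume g: "g \<in> {g \<in> carrier G. \<forall>s\<in>A. g \<otimes> s = s \<otimes> g}"
    have "inv g \<otimes> s = s \<otimes> inv g" if "s \<in> A" for s
    proof -
      have c: "g \<in> carrier G" "s \<in> carrier G" "g \<otimes> s = s \<otimes> g" using g that A by auto
      then show ?thesis by (metis inv_closed inv_solve_left inv_solve_right m_assoc m_closed)
    qed
    then show "inv g \<in> {g \<in> carrier G. \<forall>s\<in>A. g \<otimes> s = s \<otimes> g}" using g by simp
  qed (use A in auto)
  have "S \<subseteq> {g \<in> carrier G. \<forall>s\<in>S. g \<otimes> s = s \<otimes> g}" using comm assms(1) by blast
  then have 1: "generate G S \<subseteq> {g \<in> carrier G. \<forall>s\<in>S. g \<otimes> s = s \<otimes> g}"
    using generate_subgroup_incl cent[OF assms(1)] by blast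
  have gc: "generate G S \<subseteq> carrier G" using generate_incl assms(1) by blast
  have "S \<subseteq> {g \<in> carrier G. \<forall>s\<in>generate G S. g \<otimes> s = s \<otimes> g}" using 1 assms(1) by fastforce
  then have 2: "generate G S \<subseteq> {g \<in> carrier G. \<forall>s\<in>generate G S. g \<otimes> s = s \<otimes> g}"
    using generate_subgroup_incl cent[OF gc] by blast
  have "comm_group (G\<lparr>carrier := generate G S\<rparr>)"
  proof (rule group.group_comm_groupI)
    show "group (G\<lparr>carrier := generate G S\<rparr>)"
      using generate_is_subgroup assms(1) subgroup_imp_group by blast
  qed (use 2 in auto)
  then show False using assms(2) by blast
qed

lemma (in group) commutator_central_if_class2:
  assumes "nilpotent_of_class G 2" and c: "x \<in> carrier G" "y \<in> carrier G" "g \<in> carrier G"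
  shows "(x \<otimes> y \<otimes> inv x \<otimes> inv y) \<otimes> g = g \<otimes> (x \<otimes> y \<otimes> inv x \<otimes> inv y)"
proof -
  let ?k = "x \<otimes> y \<otimes> inv x \<otimes> inv y"
  let ?C = "commutator_subgroup G (carrier G) (carrier G)"
  have kc: "?k \<in> carrier G" using c by simp
  have "?k \<in> ?C" unfolding commutator_subgroup_def using c by (intro generate.incl) blast
  then have "?k \<otimes> g \<otimes> inv ?k \<otimes> inv g \<in> commutator_subgroup G ?C (carrier G)"
    unfolding commutator_subgroup_def[of G ?C] using c(3) by (intro generate.incl) blast
  also have "commutator_subgroup G ?C (carrier G) = {\<one>}"
    using assms(1) by (simp add: nilpotent_of_class_def numeral_2_eq_2)
  finally have e: "?k \<otimes> g \<otimes> inv ?k \<otimes> inv g = \<one>" by simp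
  have "?k \<otimes> g = ?k \<otimes> g \<otimes> inv ?k \<otimes> inv g \<otimes> (g \<otimes> ?k)"
    using kc c(3) by (simp add: m_assoc inv_solve_left del: inv_mult_group) (simp add: m_assoc[symmetric] del: inv_mult_group)
  also have "\<dots> = g \<otimes> ?k" unfolding e using kc c(3) by simp
  finally show ?thesis .
qed

theorem theorem3p2:
  fixes G :: "('a, 'b) monoid_scheme" (structure)
    and R :: "'a rel" and S :: "'a set" and k :: nat
  assumes "group G"
    and "torsion_free G"
    and "nilpotent_of_class G 2"
    and "ordered_group G R"
    and "S \<subseteq> carrier G" and "finite S" and "card S = k" and "k \<ge> 4"
    and "\<not> comm_group (G\<lparr>carrier := generate G S\<rparr>)"
  shows "card (S <#> S) = 3 * k - 2 \<longleftrightarrow>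
    (\<exists>a\<in>carrier G. \<exists>b\<in>carrier G. \<exists>c\<in>carrier G. \<exists>i j :: nat.
       1 + i + 1 + j = k \<and>
       S = {a \<otimes> c [^] n | n :: nat. n \<le> i} \<union> {b \<otimes> c [^] n | n :: nat. n \<le> j} \<and>
       (\<one>, c) \<in> R \<and>
       (a \<otimes> b = b \<otimes> a \<otimes> c \<or> b \<otimes> a = a \<otimes> b \<otimes> c))"
proof -
  interpret ordered_class2_group G R
    using assms(4) group.commutator_central_if_class2[OF assms(1,3)]
    by (simp add: ordered_class2_group_def ordered_class2_group_axioms_def)
  show ?thesis unfolding progression_def[symmetric]
  proof
    assume card: "card (S <#> S) = 3 * k - 2"
    obtain p q where "p \<in> S" "q \<in> S" "p \<otimes> q \<noteq> q \<otimes> p"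
      using noncommuting_generators[OF assms(5,9)] by blast
    then have "two_progressions S"
      using two_progressions_if_card_square[OF assms(6,5)] card assms(7,8) by simp
    then obtain a b c i j where c: "a \<in> carrier G" "b \<in> carrier G" "central c" "\<one> \<lless> c"
      and S: "S = progression a c i \<union> progression b c j"
      and rel: "a \<otimes> b = b \<otimes> a \<otimes> c \<or> b \<otimes> a = a \<otimes> b \<otimes> c"
      using two_progressions_positive by metis
    have cc: "c \<in> carrier G" "c \<noteq> \<one>" using c(4) by auto
    have "card (S <#> S) = 3 * (i + j) + 4"
      unfolding S using card_square_two_progressions[OF c(1-3) cc(2) rel] .
    then have "1 + i + 1 + j = k" using card assms(8) by arith
    then show "\<exists>a\<in>carrier G. \<exists>b\<in>carrier G. \<exists>c\<in>carrier G. \<exists>i j. 1 + i + 1 + j = k \<and>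
        S = progression a c i \<union> progression b c j \<and> \<one> \<lless> c \<and>
        (a \<otimes> b = b \<otimes> a \<otimes> c \<or> b \<otimes> a = a \<otimes> b \<otimes> c)"
      using c cc S rel by blast
  next
    assume "\<exists>a\<in>carrier G. \<exists>b\<in>carrier G. \<exists>c\<in>carrier G. \<exists>i j. 1 + i + 1 + j = k \<and>
        S = progression a c i \<union> progression b c j \<and> \<one> \<lless> c \<and>
        (a \<otimes> b = b \<otimes> a \<otimes> c \<or> b \<otimes> a = a \<otimes> b \<otimes> c)"
    then obtain a b c i j where c: "a \<in> carrier G" "b \<in> carrier G" "c \<in> carrier G" "\<one> \<lless> c"
      and k: "1 + i + 1 + j = k" and S: "S = progression a c i \<union> progression b c j"
      and rel: "a \<otimes> b = b \<otimes> a \<otimes> c \<or> b \<otimes> a = a \<otimes> b \<otimes> c"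
      by blast
    have "c \<noteq> \<one>" using c(4) by auto
    then have "card (S <#> S) = 3 * (i + j) + 4"
      unfolding S using card_square_two_progressions[OF c(1,2) two_progressions_central[OF c(1-3) rel]] rel
      by blast
    then show "card (S <#> S) = 3 * k - 2" using k by auto
  qed
qed

end
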